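(* Let $a_1,a_2,a_3,c_1,c_2,n$ be positive integers and let $R$ be a positive rational tangle. Then the crossing number of each of the following (quasi-alternating) Montesinos links $L$ is at most its determinant, i.e. $c(L)\le\det(L)$: (1) $L=L(a_1a_2,\,R,\,-n)$ with $1+a_1(a_2-n)<0$; (2) $L=L(a_1a_2,\,R,\,(-c_1)(-c_2))$ with $a_2<c_2$, or with $a_2=c_2$ and $a_1>c_1$; (3) $L=L(a_1a_2a_3,\,R,\,-n)$ with $a_3<n$.
   Context: $c(L)$ is the crossing number of a link $L\subset S^3$ and $\det(L)=|\Delta_L(-1)|$ its determinant. Quasi-alternating links: the set $\mathcal{Q}$ of quasi-alternating links is the smallest set of links such that (i) the unknot belongs to $\mathcal{Q}$; (ii) if $L$ is a link with a diagram containing a crossing $x$ such that both smoothings $L_0,L_1$ of the diagram at $x$ belong to $\mathcal{Q}$, $\det(L_0),\det(L_1)\ge 1$, and $\det(L)=\det(L_0)+\det(L_1)$, then $L\in\mathcal{Q}$. The links in (1)-(3) are known to be quasi-alternating. Rational tangles: for $r\in\mathbb{Q}$ let $T(r)$ be the rational tangle of slope $r$, normalized so that $T(1)$ is a fixed single (positive) crossing, $T(k)$ for an integer $k\geq 1$ is a horizontal row of $k$ such crossings, $T(1/k)$ is a vertical column of $k$ such crossings, $T(r+1)$ is the horizontal sum of $T(r)$ and $T(1)$, and $T(-r)$ is the mirror image of $T(r)$. A positive rational tangle is $T(r)$ with $r\in\mathbb{Q}$, $r>0$. Conway notation for the outer tangles: $a_1a_2$ denotes the rational tangle of slope $\dfrac{1}{a_2+\frac{1}{a_1}}=\dfrac{a_1}{1+a_1a_2}$;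 $a_1a_2a_3$ denotes the rational tangle of slope $\dfrac{1}{a_3+\frac{1}{a_2+\frac1{a_1}}}=\dfrac{1+a_1a_2}{a_1+a_3+a_1a_2a_3}$; $-n$ denotes the rational tangle of slope $-\dfrac1n$; and $(-c_1)(-c_2)$ denotes the rational tangle of slope $-\dfrac{c_1}{1+c_1c_2}$. Montesinos links: $L(A,R,B)$ is the link obtained by taking the horizontal sum of the three rational tangles $A,R,B$ in this order and forming its numerator closure (joining the two top endpoints to each other and the two bottom endpoints to each other). For slopes $\beta_i/\alpha_i$ ($i=1,2,3$) in lowest terms its determinant is $\left|\alpha_1\alpha_2\alpha_3\sum_i\beta_i/\alpha_i\right|$. *)

theory Defs
  imports "HOL-Analysis.Line_Segment" "Jordan_Normal_Form.Determinant"
begin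

section \<open>Diagrams\<close>

text \<open>
  Link and tangle diagrams are written in Morse form: a diagram is a stack of horizontal slices,
  listed from bottom to top, and a slice is a row of elementary pieces, listed from left to right.
  Every link diagram can be brought into this form by an isotopy of the plane, which leaves the
  crossings unchanged.  In a crossing, Over means that the strand from the bottom left to
  the top right is the upper one, Under that it is the lower one.
\<close>

datatype brick = Strand | Cup | Cap | Over | Under

type_synonym slice = "brick list"
type_synonym diagram = "slice list"

fun brick_bot :: "brick \<Rightarrow> nat" where
  "brick_bot Strand = 1"
| "brick_bot Cup = 0"
| "brick_bot Cap = 2"
| "brick_bot Over = 2"
| "brick_bot Under = 2"

fun brick_top :: "brick \<Rightarrow> nat" where
  "brick_top Strand = 1"
| "brick_top Cup = 2"
| "brick_top Cap = 0"
| "brick_top Over = 2"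
| "brick_top Under = 2"

definition slice_bot :: "slice \<Rightarrow> nat" where
  "slice_bot s = sum_list (map brick_bot s)"

definition slice_top :: "slice \<Rightarrow> nat" where
  "slice_top s = sum_list (map brick_top s)"

text \<open>\<open>is_diagram m D n\<close>: the slices fit together, with m endpoints at the bottom and n at the top.\<close>

fun is_diagram :: "nat \<Rightarrow> diagram \<Rightarrow> nat \<Rightarrow> bool" where
  "is_diagram m [] n \<longleftrightarrow> m = n"
| "is_diagram m (s # D) n \<longleftrightarrow> slice_bot s = m \<and> is_diagram (slice_top s) D n"

abbreviation link_diagram :: "diagram \<Rightarrow> bool" where
  "link_diagram D \<equiv> is_diagram 0 D 0"

definition crossings :: "diagram \<Rightarrow> nat" where
  "crossings D = length (filter (\<lambda>k. k = Over \<or> k = Under) (concat D))"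

text \<open>
  \<open>place_slice s b a\<close> lists the bricks k of s as triples (k, b', a'), where b' is the number of
  the leftmost bottom endpoint of k and a' that of its leftmost top endpoint, the endpoints of s
  being numbered from left to right, starting with b at the bottom and with a at the top.
\<close>

fun place_slice :: "slice \<Rightarrow> nat \<Rightarrow> nat \<Rightarrow> (brick \<times> nat \<times> nat) list" where
  "place_slice [] b a = []"
| "place_slice (k # s) b a = (k, b, a) # place_slice s (b + brick_bot k) (a + brick_top k)"

section \<open>Links in space and the crossing number\<close>

text \<open>
  The link of a diagram: slice number j occupies the region between the heights j and j + 1 of the
  second coordinate, the endpoints on each level sit at first coordinates 0, 1, 2, ..., and the third
  coordinate points towards the viewer.  At half height a brick with leftmost endpoints b (bottom)
  and a (top) sits between its neighbours at first coordinate about (a + b) / 2, so the pieces of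
  one slice do not meet, and the upper strand of a crossing is lifted to third coordinate 1 above
  the double point.
\<close>

type_synonym point = "real \<times> real \<times> real"

fun brick_arcs :: "real \<Rightarrow> brick \<times> nat \<times> nat \<Rightarrow> point set" where
  "brick_arcs j (Strand, b, a) = closed_segment (real b, j, 0) (real a, j + 1, 0)"
| "brick_arcs j (Cup, b, a) =
     (let m = ((real a + real b) / 2, j + 1 / 2, 0) in
        closed_segment m (real a, j + 1, 0) \<union> closed_segment m (real a + 1, j + 1, 0))"
| "brick_arcs j (Cap, b, a) =
     (let m = ((real a + real b) / 2, j + 1 / 2, 0) in
        closed_segment (real b, j, 0) m \<union> closed_segment (real b + 1, j, 0) m)"
| "brick_arcs j (Over, b, a) =
     (let m = ((real a + real b + 1) / 2, j + 1 / 2, 1) in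
        closed_segment (real b, j, 0) m \<union> closed_segment m (real a + 1, j + 1, 0) \<union>
        closed_segment (real b + 1, j, 0) (real a, j + 1, 0))"
| "brick_arcs j (Under, b, a) =
     (let m = ((real a + real b + 1) / 2, j + 1 / 2, 1) in
        closed_segment (real b + 1, j, 0) m \<union> closed_segment m (real a, j + 1, 0) \<union>
        closed_segment (real b, j, 0) (real a + 1, j + 1, 0))"

definition link_of :: "diagram \<Rightarrow> point set" where
  "link_of D = (\<Union>j < length D. \<Union>p \<in> set (place_slice (D ! j) 0 0). brick_arcs (real j) p)"

text \<open>Links in the 3-sphere are isotopic iff they are isotopic in the complement of a point.\<close>

definition ambient_isotopic :: "point set \<Rightarrow> point set \<Rightarrow> bool" where
  "ambient_isotopic K K' \<longleftrightarrow>
     (\<exists>H :: real \<Rightarrow> point \<Rightarrow> point.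
        continuous_on ({0..1} \<times> UNIV) (\<lambda>(t, x). H t x) \<and>
        (\<forall>t\<in>{0..1}. \<exists>G. homeomorphism UNIV UNIV (H t) G) \<and>
        (\<forall>x. H 0 x = x) \<and> H 1 ` K = K')"

definition crossing_number :: "point set \<Rightarrow> nat" where
  "crossing_number K =
     (LEAST n. \<exists>D. link_diagram D \<and> ambient_isotopic (link_of D) K \<and> crossings D = n)"

section \<open>Alexander polynomial and determinant\<close>

text \<open>
  The edges of a diagram are the points where it meets the levels between the slices; they are
  numbered level by level from the bottom, and from left to right in each level.  Unlike in
  \<open>link_of\<close>, the numbers in \<open>place D\<close> are these global ones.
\<close>

fun place_from :: "nat \<Rightarrow> diagram \<Rightarrow> (brick \<times> nat \<times> nat) list" where
  "place_from b [] = []"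
| "place_from b (s # D) = place_slice s b (b + slice_bot s) @ place_from (b + slice_bot s) D"

abbreviation place :: "diagram \<Rightarrow> (brick \<times> nat \<times> nat) list" where
  "place \<equiv> place_from 0"

definition edges :: "diagram \<Rightarrow> nat" where
  "edges D = sum_list (map slice_bot D)"

text \<open>An orientation tells for every edge whether the link runs upwards (True) or downwards.\<close>

fun brick_oriented :: "(nat \<Rightarrow> bool) \<Rightarrow> brick \<times> nat \<times> nat \<Rightarrow> bool" where
  "brick_oriented up (Strand, b, a) \<longleftrightarrow> up b = up a"
| "brick_oriented up (Cup, b, a) \<longleftrightarrow> up a \<noteq> up (a + 1)"
| "brick_oriented up (Cap, b, a) \<longleftrightarrow> up b \<noteq> up (b + 1)"
| "brick_oriented up (Over, b, a) \<longleftrightarrow> up b = up (a + 1) \<and> up (b + 1) = up a"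
| "brick_oriented up (Under, b, a) \<longleftrightarrow> up b = up (a + 1) \<and> up (b + 1) = up a"

definition orientation :: "diagram \<Rightarrow> (nat \<Rightarrow> bool) \<Rightarrow> bool" where
  "orientation D up \<longleftrightarrow> (\<forall>p\<in>set (place D). brick_oriented up p)"

text \<open>
  The rows of the Alexander matrix come from the Wirtinger presentation of the link group, with one
  generator for every edge.  The edges of a strand that does not pass under a crossing have equal
  generators.  At a crossing let x be the generator of the upper strand and l, r those of the edges
  of the lower strand to the left and to the right of the (oriented) upper strand; the relation
  r = x l x^(-1) has Fox derivative (1 - t) x + t l - r.
\<close>

definition gen :: "nat \<Rightarrow> nat \<Rightarrow> int poly" where
  "gen i j = (if i = j then 1 else 0)"

definition eq_row :: "nat \<Rightarrow> nat \<Rightarrow> nat \<Rightarrow> int poly" where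
  "eq_row x y = (\<lambda>j. gen x j - gen y j)"

definition fox_row :: "nat \<Rightarrow> nat \<Rightarrow> nat \<Rightarrow> nat \<Rightarrow> int poly" where
  "fox_row x l r = (\<lambda>j. (1 - [:0, 1:]) * gen x j + [:0, 1:] * gen l j - gen r j)"

fun brick_rows :: "(nat \<Rightarrow> bool) \<Rightarrow> brick \<times> nat \<times> nat \<Rightarrow> (nat \<Rightarrow> int poly) list" where
  "brick_rows up (Strand, b, a) = [eq_row b a]"
| "brick_rows up (Cup, b, a) = [eq_row a (a + 1)]"
| "brick_rows up (Cap, b, a) = [eq_row b (b + 1)]"
| "brick_rows up (Over, b, a) =
     [eq_row b (a + 1), if up b then fox_row b a (b + 1) else fox_row b (b + 1) a]"
| "brick_rows up (Under, b, a) =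
     [eq_row (b + 1) a, if up (b + 1) then fox_row (b + 1) b (a + 1) else fox_row (b + 1) (a + 1) b]"

definition alexander_rows :: "diagram \<Rightarrow> (nat \<Rightarrow> bool) \<Rightarrow> (nat \<Rightarrow> int poly) list" where
  "alexander_rows D up = concat (map (brick_rows up) (place D))"

definition alexander_matrix :: "diagram \<Rightarrow> (nat \<Rightarrow> bool) \<Rightarrow> int poly mat" where
  "alexander_matrix D up =
     mat (length (alexander_rows D up)) (edges D) (\<lambda>(i, j). (alexander_rows D up ! i) j)"

text \<open>
  For a link diagram the Alexander matrix is square (see \<open>length_alexander_rows\<close> below).
  As usual, one row and one column are deleted; the result is the Alexander polynomial up to a
  unit of the Laurent polynomial ring, that is, up to sign and a power of t.
\<close>

definition alexander_poly :: "diagram \<Rightarrow> (nat \<Rightarrow> bool) \<Rightarrow> int poly" where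
  "alexander_poly D up = det (mat_delete (alexander_matrix D up) 0 0)"

text \<open>The choice of the orientation is irrelevant, see \<open>link_det_eq\<close> below.\<close>

definition link_det :: "diagram \<Rightarrow> int" where
  "link_det D = \<bar>poly (alexander_poly D (SOME up. orientation D up)) (- 1)\<bar>"

section \<open>Rational tangles and Montesinos links\<close>

text \<open>Tangles are diagrams with two endpoints at the bottom and two at the top.\<close>

definition hsum :: "diagram \<Rightarrow> diagram \<Rightarrow> diagram" where
  "hsum A B =
     [[Strand, Cup, Strand]] @
     map (\<lambda>s. s @ [Strand, Strand]) A @ map (\<lambda>s. [Strand, Strand] @ s) B @
     [[Strand, Cap, Strand]]"

definition mirror :: "diagram \<Rightarrow> diagram" where
  "mirror D = map (map (\<lambda>k. if k = Over then Under else if k = Under then Over else k)) D"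

definition numerator_closure :: "diagram \<Rightarrow> diagram" where
  "numerator_closure A = [[Cup]] @ A @ [[Cap]]"

text \<open>
  The tangle of slope p/q, for p \<ge> 0 and q > 0.  Besides T(r + 1) = T(r) + T(1) this uses
  T(1 / (1 + 1/r)) = T(r) * T(1) with the vertical sum *, which is obtained from the former by
  the rotation of a quarter turn followed by the mirror image; it takes slope r to 1/r and the
  crossing T(1) to itself.
\<close>

fun fraction_tangle :: "nat \<Rightarrow> nat \<Rightarrow> diagram" where
  "fraction_tangle p q =
     (if p = 0 \<or> q = 0 then [[Cap], [Cup]]
      else if p = q then [[Over]]
      else if p > q then hsum (fraction_tangle (p - q) q) [[Over]]
      else fraction_tangle p (q - p) @ [[Over]])"

declare fraction_tangle.simps [simp del]

definition rational_tangle :: "rat \<Rightarrow> diagram" where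
  "rational_tangle r =
     (let (p, q) = quotient_of r in
        if p \<ge> 0 then fraction_tangle (nat p) (nat q)
        else mirror (fraction_tangle (nat (- p)) (nat q)))"

definition montesinos :: "rat \<Rightarrow> rat \<Rightarrow> rat \<Rightarrow> diagram" where
  "montesinos u v w =
     numerator_closure (hsum (hsum (rational_tangle u) (rational_tangle v)) (rational_tangle w))"

definition conway2 :: "nat \<Rightarrow> nat \<Rightarrow> rat" where
  "conway2 a b = 1 / (of_nat b + 1 / of_nat a)"

definition conway3 :: "nat \<Rightarrow> nat \<Rightarrow> nat \<Rightarrow> rat" where
  "conway3 a b c = 1 / (of_nat c + 1 / (of_nat b + 1 / of_nat a))"

section \<open>Basic facts\<close>

lemma is_diagram_append:
  "is_diagram m A k \<Longrightarrow> is_diagram k B n \<Longrightarrow> is_diagram m (A @ B) n"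
  by (induction A arbitrary: m) auto

lemma is_diagram_hsum:
  assumes "is_diagram 2 A 2" "is_diagram 2 B 2"
  shows "is_diagram 2 (hsum A B) 2"
proof -
  have 1: "is_diagram m A n \<Longrightarrow> is_diagram (m + 2) (map (\<lambda>s. s @ [Strand, Strand]) A) (n + 2)"
    for m n A
    by (induction A arbitrary: m) (auto simp: slice_bot_def slice_top_def)
  have 2: "is_diagram m A n \<Longrightarrow> is_diagram (m + 2) (map (\<lambda>s. [Strand, Strand] @ s) A) (n + 2)"
    for m n A
    by (induction A arbitrary: m) (auto simp: slice_bot_def slice_top_def)
  have bot: "is_diagram 2 [[Strand, Cup, Strand]] (2 + 2)"
    and top: "is_diagram (2 + 2) [[Strand, Cap, Strand]] 2"
    by (simp_all add: slice_bot_def slice_top_def)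
  show ?thesis
    unfolding hsum_def
    by (rule is_diagram_append[OF bot is_diagram_append[OF 1[OF assms(1)]
          is_diagram_append[OF 2[OF assms(2)] top]]])
qed

lemma is_diagram_mirror: "is_diagram m (mirror A) n \<longleftrightarrow> is_diagram m A n"
proof -
  let ?f = "\<lambda>k. if k = Over then Under else if k = Under then Over else k"
  have "brick_bot (?f k) = brick_bot k" "brick_top (?f k) = brick_top k" for k
    by (cases k; simp)+
  then have "slice_bot (map ?f s) = slice_bot s" "slice_top (map ?f s) = slice_top s" for s
    by (simp_all add: slice_bot_def slice_top_def o_def del: if_image_distrib)
  then show ?thesis
    unfolding mirror_def by (induction A arbitrary: m) auto
qed

lemma is_diagram_fraction_tangle: "is_diagram 2 (fraction_tangle p q) 2"
proof (induction p q rule: fraction_tangle.induct)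
  case (1 p q)
  have c: "is_diagram 2 [[Over]] 2" "is_diagram 2 [[Cap], [Cup]] 2"
    by (simp_all add: slice_bot_def slice_top_def)
  show ?case
    using 1 c by (subst fraction_tangle.simps) (auto intro: is_diagram_hsum is_diagram_append)
qed

lemma is_diagram_rational_tangle: "is_diagram 2 (rational_tangle r) 2"
  by (simp add: rational_tangle_def is_diagram_mirror is_diagram_fraction_tangle
      split: prod.split)

lemma link_diagram_montesinos: "link_diagram (montesinos u v w)"
proof -
  have ends: "is_diagram 0 [[Cup]] 2" "is_diagram 2 [[Cap]] 0"
    by (simp_all add: slice_bot_def slice_top_def)
  show ?thesis
    unfolding montesinos_def numerator_closure_def
    by (rule is_diagram_append[OF ends(1) is_diagram_append[OF _ ends(2)]])
       (intro is_diagram_hsum is_diagram_rational_tangle)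
qed

lemma rational_tangle_1: "rational_tangle 1 = [[Over]]"
  by (simp add: rational_tangle_def fraction_tangle.simps)

lemma rational_tangle_uminus: "rational_tangle (- r) = mirror (rational_tangle r)"
proof -
  have "fraction_tangle 0 q = mirror (fraction_tangle 0 q)" for q
    by (simp add: fraction_tangle.simps mirror_def)
  moreover have "mirror (mirror A) = A" for A
    unfolding mirror_def by (induction A) (auto simp: o_def intro!: map_idI)
  ultimately show ?thesis
    by (cases "quotient_of r") (auto simp: rational_tangle_def rat_uminus_code)
qed

lemma rational_tangle_pos:
  assumes "p > 0" "q > 0" "coprime p q"
  shows "rational_tangle (of_nat p / of_nat q) = fraction_tangle p q"
proof -
  have "quotient_of (of_nat p / of_nat q) = (int p, int q)"
    using assms quotient_of_Fract[of "int p" "int q"]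
    by (simp add: Fract_of_int_quotient normalize_stable)
  then show ?thesis
    by (simp add: rational_tangle_def)
qed

lemma pos_rat_cases:
  assumes "(r :: rat) > 0"
  obtains p q :: nat where "p > 0" "q > 0" "coprime p q" "r = of_nat p / of_nat q"
proof -
  obtain a b where ab: "quotient_of r = (a, b)" by (cases "quotient_of r")
  then have b: "b > 0" "coprime a b" "r = of_int a / of_int b"
    by (auto simp: quotient_of_denom_pos quotient_of_coprime quotient_of_div)
  then have a: "a > 0" using assms by (simp add: zero_less_divide_iff)
  show ?thesis
    using a b by (intro that[of "nat a" "nat b"]) (auto simp: coprime_int_iff[symmetric])
qed

lemma rational_tangle_add_1:
  assumes "r > 0"
  shows "rational_tangle (r + 1) = hsum (rational_tangle r) (rational_tangle 1)"
proof -
  obtain p q :: nat where pq: "p > 0" "q > 0" "coprime p q" "r = of_nat p / of_nat q"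
    using pos_rat_cases[OF assms] .
  then have "r + 1 = of_nat (p + q) / of_nat q" by (simp add: field_simps)
  then have "rational_tangle (r + 1) = fraction_tangle (p + q) q"
    using pq by (metis rational_tangle_pos coprime_add_one_left add_gr_0 coprime_iff_gcd_eq_1 gcd_add1)
  then show ?thesis
    using pq by (subst (asm) fraction_tangle.simps)
      (simp add: rational_tangle_1 rational_tangle_pos)
qed

lemma rational_tangle_vertical:
  assumes "r > 0"
  shows "rational_tangle (1 / (1 / r + 1)) = rational_tangle r @ rational_tangle 1"
proof -
  obtain p q :: nat where pq: "p > 0" "q > 0" "coprime p q" "r = of_nat p / of_nat q"
    using pos_rat_cases[OF assms] .
  have "1 / (1 / (x / y) + 1) = x / (x + y)" if "x > 0" "y > 0" for x y :: rat
    using that by (simp add: field_simps)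
  from this[of "of_nat p" "of_nat q"] pq
  have "1 / (1 / r + 1) = of_nat p / of_nat (p + q)" by simp
  then have "rational_tangle (1 / (1 / r + 1)) = fraction_tangle p (p + q)"
    using pq by (metis rational_tangle_pos add_gr_0 coprime_iff_gcd_eq_1 gcd_add2)
  then show ?thesis
    using pq by (subst (asm) fraction_tangle.simps)
      (simp add: rational_tangle_1 rational_tangle_pos)
qed

lemma conway2_eq: "a > 0 \<Longrightarrow> conway2 a b = of_nat a / of_nat (1 + a * b)"
  by (simp add: conway2_def field_simps)

lemma conway3_eq:
  assumes "a > 0"
  shows "conway3 a b c = of_nat (1 + a * b) / of_nat (a + c + a * b * c)"
proof -
  have "1 / (z + 1 / (y + 1 / x)) = (1 + x * y) / (x + z + x * y * z)"
    if "x > 0" "y \<ge> 0" "z \<ge> 0" for x y z :: rat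
  proof -
    have "1 + x * y > 0" using that by (simp add: add_pos_nonneg)
    moreover have "y + 1 / x = (1 + x * y) / x" using that by (simp add: field_simps)
    ultimately show ?thesis by (simp add: field_simps)
  qed
  from this[of "of_nat a" "of_nat b" "of_nat c"] assms show ?thesis
    by (simp add: conway3_def)
qed

lemma length_alexander_rows:
  assumes "link_diagram D"
  shows "length (alexander_rows D up) = edges D"
proof -
  have s: "2 * length (concat (map (brick_rows up) (place_slice s b a))) = slice_bot s + slice_top s"
    for s b a
  proof (induction s arbitrary: b a)
    case (Cons k s)
    then show ?case by (cases k) (simp_all add: slice_bot_def slice_top_def)
  qed (simp add: slice_bot_def slice_top_def)
  have "is_diagram m D n \<Longrightarrow>
      2 * length (concat (map (brick_rows up) (place_from b D))) + m = 2 * edges D + n" for m n b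
  proof (induction D arbitrary: m b)
    case (Cons c D)
    show ?case
      using Cons.IH[of "slice_top c" "b + slice_bot c"] Cons.prems s[of c b "b + slice_bot c"]
      by (simp add: edges_def)
  qed (simp add: edges_def)
  from this[OF assms] show ?thesis by (simp add: alexander_rows_def)
qed

lemma link_det_eq:
  assumes "orientation D up"
  shows "link_det D = \<bar>poly (alexander_poly D up) (- 1)\<bar>"
proof -
  let ?e = "\<lambda>p :: int poly. poly p (- 1)"
  interpret e: comm_ring_hom ?e by unfold_locales simp_all
  have brick: "map (\<lambda>f. ?e \<circ> f) (brick_rows up1 p) = map (\<lambda>f. ?e \<circ> f) (brick_rows up2 p)"
    for up1 up2 p
    by (cases "(up1, p)" rule: brick_rows.cases) (auto simp: fox_row_def fun_eq_iff)
  have rows: "map (\<lambda>f. ?e \<circ> f) (alexander_rows D up1) = map (\<lambda>f. ?e \<circ> f) (alexander_rows D up2)"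
    for up1 up2
    unfolding alexander_rows_def map_concat map_map o_def
    by (simp only: brick[unfolded o_def, of up1 _ up2])
  have len: "length (alexander_rows D up1) = length (alexander_rows D up2)" for up1 up2
    using rows[of up1 up2] by (metis length_map)
  have entry: "?e ((alexander_rows D up1 ! i) j) = ?e ((alexander_rows D up2 ! i) j)"
    if "i < length (alexander_rows D up1)" for up1 up2 i j
    using arg_cong[OF rows[of up1 up2], of "\<lambda>xs. (xs ! i) j"] that len[of up1 up2] by simp
  have "map_mat ?e (mat_delete (alexander_matrix D up1) 0 0) =
        map_mat ?e (mat_delete (alexander_matrix D up2) 0 0)" for up1 up2
    unfolding alexander_matrix_def mat_delete_def
    by (rule eq_matI) (use len[of up1 up2] in \<open>auto intro!: entry\<close>)
  then have "?e (alexander_poly D up1) = ?e (alexander_poly D up2)" for up1 up2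
    unfolding alexander_poly_def by (metis e.hom_det)
  then show ?thesis unfolding link_det_def by metis
qed

end

theory Submission
  imports Defs
begin

text \<open>
  The standard diagram is already good enough: the tangle of slope p/q has at most p + q - 1
  crossings, whereas the determinant is
  q2 (p1 q3 - q1 p3) + p2 q1 q3 for slopes p1/q1, p2/q2 and - p3/q3, and each of the three
  hypotheses gives p1 q3 - q1 p3 > 0.

  The determinant only has to be bounded from below.  It is the order of the group presented by the
  Fox colouring conditions (with one colour set to 0), provided that it does not vanish.  It does not
  vanish because only the zero colouring satisfies all conditions.  A rational tangle has one
  colouring up to a base colour and a scale, so letting the three scales vary freely gives a surjection
  from the presented group onto the one generated by the scales, whose 3 by 3 relation matrix has the
  determinant above.
\<close>

text \<open>Evaluating the determinant exactly would need an induction over matrices that grow with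
  every gluing of tangles. A lower bound is easier, because a nonzero integer is at least as large
  in absolute value as each of its divisors. Divisibility needs just one colouring modulo the
  relation matrix, nonvanishing a description of all exact integer colourings, and both behave well
  under gluing. The middle tangle is arbitrary, so its contribution has to drop out of the
  comparison. With p1 q3 - q1 p3 >= 1 and q1 q3 >= 1 the determinant is at least q2 + p2 + q1 q3 -
  1. The standard diagram has at most p1 + q1 + p2 + q2 + p3 + q3 - 3 crossings. What remains is p1
  + q1 + p3 + q3 <= q1 q3 + 2, a condition on the outer tangles alone, to be checked in each of the
  three families.\<close>

section \<open>Determinants\<close>

text \<open>Read the rows of A and of P as relations. \<open>A * X = Y * P\<close> says that X
  induces a map between the presented groups, and \<open>Z * X = 1\<close> makes it surjective. For
  integers this is divisibility of group orders; block matrices give it without speaking of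
  quotients.\<close>

lemma det_dvd_det:
  fixes A :: "'a :: idom mat"
  assumes A: "A \<in> carrier_mat n n" and X: "X \<in> carrier_mat n k" and Y: "Y \<in> carrier_mat n k"
    and P: "P \<in> carrier_mat k k" and Z: "Z \<in> carrier_mat k n"
    and AX: "A * X = Y * P" and ZX: "Z * X = 1\<^sub>m k"
  shows "det P dvd det A"
proof -
  let ?O = "0\<^sub>m n k" and ?O' = "0\<^sub>m k n"
  let ?U = "four_block_mat (1\<^sub>m n) X Z (0\<^sub>m k k)"
  let ?V = "four_block_mat A Y Z (0\<^sub>m k k)"
  let ?S = "four_block_mat (1\<^sub>m n) (- X) ?O' (1\<^sub>m k)"
  have carr: "?U \<in> carrier_mat (n + k) (n + k)" "?V \<in> carrier_mat (n + k) (n + k)"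
    "?S \<in> carrier_mat (n + k) (n + k)"
    using A X Y Z by simp_all
  note mult = mult_four_block_mat[where ?nr1.0=n and ?n1.0=n and ?n2.0=k and ?nr2.0=k
      and ?nc1.0=n and ?nc2.0=k]
  \<comment> \<open>A column operation clears X from the upper right block of \<open>?U\<close>; the
    lower right block becomes - Z X, so the determinant of \<open>?U\<close> is a sign.\<close>
  have "?U * ?S = four_block_mat (1\<^sub>m n) ?O Z (- (1\<^sub>m k))"
    using X Z ZX by (subst mult) (auto intro!: cong_four_block_mat)
  moreover have "det ?S = 1"
    using X by (subst det_four_block_mat_lower_left_zero[where n=n and m=k]) auto
  ultimately have "det ?U = det (- (1\<^sub>m k) :: 'a mat)"
    using det_mult[OF carr(1,3)] Z
    by (simp add: det_four_block_mat_upper_right_zero[where n=n and m=k])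
  also have "(- (1\<^sub>m k) :: 'a mat) = (- 1) \<cdot>\<^sub>m 1\<^sub>m k" by auto
  also have "det \<dots> = (- 1) ^ k" by (simp add: det_smult)
  finally have U: "det ?U = (- 1) ^ k" .
  \<comment> \<open>Both products have the blocks A, A X = Y P, Z and 0.\<close>
  have eq: "four_block_mat A ?O ?O' (1\<^sub>m k) * ?U = ?V * four_block_mat (1\<^sub>m n) ?O ?O' P"
    using A X Y Z P AX
    by (simp add: mult)
  have "det A * det ?U = det ?V * det P"
    using arg_cong[OF eq, of det] A P carr
    by (simp add: det_mult[where n="n + k"] det_four_block_mat_upper_right_zero[where n=n and m=k])
  then have "det P dvd det A * (- 1) ^ k" unfolding U by (metis dvd_triv_right)
  moreover have "det A * (- 1) ^ k * (- 1) ^ k = det A"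
    by (simp add: mult.assoc power_mult_distrib[symmetric])
  ultimately show ?thesis by (metis dvd_mult2)
qed

lemma det_dim_2:
  assumes "A \<in> carrier_mat 2 2"
  shows "det A = A $$ (0, 0) * A $$ (1, 1) - A $$ (0, 1) * (A $$ (1, 0) :: 'a :: comm_ring_1)"
  using assms
  by (subst laplace_expansion_row[OF assms, of 0])
    (auto simp: numeral_2_eq_2 cofactor_def det_single mat_delete_def)

lemma det_dim_3:
  assumes A: "A \<in> carrier_mat 3 3"
  shows "det A = A $$ (0, 0) * (A $$ (1, 1) * A $$ (2, 2) - A $$ (1, 2) * A $$ (2, 1))
    + A $$ (0, 1) * (A $$ (1, 2) * A $$ (2, 0) - A $$ (1, 0) * A $$ (2, 2))
    + A $$ (0, 2) * (A $$ (1, 0) * A $$ (2, 1) - A $$ (1, 1) * (A $$ (2, 0) :: 'a :: comm_ring_1))"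
proof -
  have minor: "det (mat_delete A 0 j) = mat_delete A 0 j $$ (0, 0) * mat_delete A 0 j $$ (1, 1)
      - mat_delete A 0 j $$ (0, 1) * mat_delete A 0 j $$ (1, 0)" for j
    using mat_delete_carrier[OF A, of 0 j] by (intro det_dim_2) simp
  have entry: "mat_delete A 0 j $$ (i, k) = A $$ (Suc i, if k < j then k else Suc k)"
    if "i < 2" "k < 2" for i j k
    using A that by (auto simp: mat_delete_def)
  have "det A = (\<Sum>j<3. A $$ (0, j) * cofactor A 0 j)"
    by (rule laplace_expansion_row[OF A]) simp
  then show ?thesis
    by (simp add: numeral_3_eq_3 cofactor_def minor entry numeral_2_eq_2)
qed

section \<open>Colourings\<close>

text \<open>
  At t = -1 the rows of the Alexander matrix are the Fox colouring conditions.  A colouring is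
  recorded by the list of the colours on every level, and its conditions are only required modulo H.
\<close>

fun brick_col :: "'a::comm_ring_1 set \<Rightarrow> brick \<Rightarrow> 'a list \<Rightarrow> 'a list \<Rightarrow> bool" where
  "brick_col H Strand [x] [y] \<longleftrightarrow> x - y \<in> H"
| "brick_col H Cup [] [y, y'] \<longleftrightarrow> y - y' \<in> H"
| "brick_col H Cap [x, x'] [] \<longleftrightarrow> x - x' \<in> H"
| "brick_col H Over [x, x'] [y, y'] \<longleftrightarrow> x - y' \<in> H \<and> 2 * x - x' - y \<in> H"
| "brick_col H Under [x, x'] [y, y'] \<longleftrightarrow> x' - y \<in> H \<and> 2 * x' - x - y' \<in> H"
| "brick_col H _ _ _ \<longleftrightarrow> False"

fun slice_col :: "'a::comm_ring_1 set \<Rightarrow> slice \<Rightarrow> 'a list \<Rightarrow> 'a list \<Rightarrow> bool" where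
  "slice_col H [] xs ys \<longleftrightarrow> xs = [] \<and> ys = []"
| "slice_col H (k # s) xs ys \<longleftrightarrow>
     brick_col H k (take (brick_bot k) xs) (take (brick_top k) ys) \<and>
     slice_col H s (drop (brick_bot k) xs) (drop (brick_top k) ys)"

fun diagram_col :: "'a::comm_ring_1 set \<Rightarrow> diagram \<Rightarrow> 'a list list \<Rightarrow> bool" where
  "diagram_col H [] L \<longleftrightarrow> (\<exists>xs. L = [xs])"
| "diagram_col H (s # D) [] \<longleftrightarrow> False"
| "diagram_col H (s # D) (xs # L) \<longleftrightarrow> L \<noteq> [] \<and> slice_col H s xs (hd L) \<and> diagram_col H D L"

text \<open>Colours may lie in any commutative ring: integers serve for the kernel of the matrix,
  integer polynomials for colourings with free parameters.\<close>

definition eval_row :: "nat \<Rightarrow> (nat \<Rightarrow> 'a::comm_ring_1) \<Rightarrow> (nat \<Rightarrow> int poly) \<Rightarrow> 'a" where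
  "eval_row N c f = (\<Sum>j<N. of_int (poly (f j) (- 1)) * c j)"

lemma eval_row_gen: "x < N \<Longrightarrow> (\<Sum>j<N. of_int (poly (gen x j) (- 1)) * c j) = c x"
  by (simp add: gen_def if_distrib[of "\<lambda>p. poly p _"] if_distrib[of of_int]
      if_distrib[of "\<lambda>z. z * _"] sum.delta' cong: if_cong)

lemma eval_row_eq_row:
  assumes "x < N" "y < N"
  shows "eval_row N c (eq_row x y) = c x - c y"
proof -
  have "eval_row N c (eq_row x y) =
      (\<Sum>j<N. of_int (poly (gen x j) (- 1)) * c j) - (\<Sum>j<N. of_int (poly (gen y j) (- 1)) * c j)"
    by (simp add: eval_row_def eq_row_def algebra_simps sum_subtractf)
  then show ?thesis using assms by (simp add: eval_row_gen)
qed

lemma eval_row_fox_row: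
  assumes "x < N" "l < N" "r < N"
  shows "eval_row N c (fox_row x l r) = 2 * c x - c l - c r"
proof -
  let ?g = "\<lambda>x. \<Sum>j<N. of_int (poly (gen x j) (- 1)) * c j"
  have "of_int (poly (fox_row x l r j) (- 1)) * c j =
      2 * (of_int (poly (gen x j) (- 1)) * c j) - of_int (poly (gen l j) (- 1)) * c j -
      of_int (poly (gen r j) (- 1)) * c j" for j
    by (simp add: fox_row_def algebra_simps)
  then have "eval_row N c (fox_row x l r) = 2 * ?g x - ?g l - ?g r"
    by (simp add: eval_row_def sum_subtractf sum_distrib_left)
  then show ?thesis using assms by (simp add: eval_row_gen)
qed

text \<open>At -1 a Fox row becomes 2 x - l - r, which is symmetric in l and r, so the orientation
  disappears from the right-hand side.\<close>

lemma brick_rows_col: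
  assumes "b + brick_bot k \<le> N" "a + brick_top k \<le> N"
  shows "(\<forall>f\<in>set (brick_rows up (k, b, a)). eval_row N c f \<in> H) \<longleftrightarrow>
    brick_col H k (map c [b..<b + brick_bot k]) (map c [a..<a + brick_top k])"
  using assms
  by (cases k) (auto simp: upt_rec eval_row_eq_row eval_row_fox_row algebra_simps)

lemma slice_rows_col:
  assumes "b + slice_bot s \<le> N" "a + slice_top s \<le> N"
  shows "(\<forall>p\<in>set (place_slice s b a). \<forall>f\<in>set (brick_rows up p). eval_row N c f \<in> H) \<longleftrightarrow>
    slice_col H s (map c [b..<b + slice_bot s]) (map c [a..<a + slice_top s])"
  using assms
proof (induction s arbitrary: b a)
  case Nil
  show ?case by (simp add: slice_bot_def slice_top_def)
next
  case (Cons k s)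
  have le: "b + brick_bot k \<le> N" "a + brick_top k \<le> N"
      "b + brick_bot k + slice_bot s \<le> N" "a + brick_top k + slice_top s \<le> N"
    using Cons.prems by (simp_all add: slice_bot_def slice_top_def)
  show ?case
    using Cons.IH[OF le(3,4)] brick_rows_col[OF le(1,2), of up c H]
    by (simp add: slice_bot_def slice_top_def take_map drop_map add.assoc)
qed

section \<open>From numbered edges to lists of levels\<close>

fun levels :: "(nat \<Rightarrow> 'a) \<Rightarrow> nat \<Rightarrow> nat list \<Rightarrow> 'a list list" where
  "levels c b [] = []"
| "levels c b (w # ws) = map c [b..<b + w] # levels c (b + w) ws"

lemma concat_levels: "concat (levels c b ws) = map c [b..<b + sum_list ws]"
proof (induction ws arbitrary: b)
  case (Cons w ws)
  then show ?case using upt_add_eq_append[of b "b + w" "sum_list ws"] by (simp add: add.assoc)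
qed simp

text \<open>The top endpoints of a slice are numbered from \<open>b + slice_bot s\<close>, exactly
  where the next level starts, so neighbouring slices share these colours. \<open>edges\<close>
  counts the bottom level of each slice only; the topmost level accounts for the extra n.\<close>

lemma diagram_rows_col:
  assumes "is_diagram m D n" "b + edges D + n \<le> N"
  shows "(\<forall>p\<in>set (place_from b D). \<forall>f\<in>set (brick_rows up p). eval_row N c f \<in> H) \<longleftrightarrow>
    diagram_col H D (levels c b (map slice_bot D @ [n]))"
  using assms
proof (induction D arbitrary: m b)
  case (Cons s D)
  have D: "is_diagram (slice_top s) D n" using Cons.prems by simp
  have hd: "hd (levels c (b + slice_bot s) (map slice_bot D @ [n])) =
      map c [b + slice_bot s..<b + slice_bot s + slice_top s]"
    using D by (cases D) auto
  have "slice_top s \<le> edges D + n" using D by (cases D) (auto simp: edges_def)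
  then show ?case
    using Cons.IH[OF D, of "b + slice_bot s"] Cons.prems hd
      slice_rows_col[of b s N "b + slice_bot s" up c H]
    by (cases D) (simp_all add: edges_def add.assoc ball_Un)
qed simp

text \<open>Serves to turn a colouring constructed level by level back into a function of the edge
  number, as the matrix requires.\<close>

lemma levels_nth:
  "(\<And>j. j < length (concat L) \<Longrightarrow> c (b + j) = concat L ! j) \<Longrightarrow> levels c b (map length L) = L"
proof (induction L arbitrary: b)
  case (Cons xs L)
  have "map c [b..<b + length xs] = xs"
  proof (rule nth_equalityI)
    fix i assume "i < length (map c [b..<b + length xs])"
    then show "map c [b..<b + length xs] ! i = xs ! i"
      using Cons.prems[of i] by (simp add: nth_append)
  qed simp
  moreover have "levels c (b + length xs) (map length L) = L"
  proof (rule Cons.IH)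
    fix j assume "j < length (concat L)"
    then show "c (b + length xs + j) = concat L ! j"
      using Cons.prems[of "length xs + j"] by (simp add: nth_append add.assoc)
  qed
  ultimately show ?case by simp
qed simp

lemma brick_col_length: "brick_col H k xs ys \<Longrightarrow> length xs = brick_bot k \<and> length ys = brick_top k"
  by (induction H k xs ys rule: brick_col.induct) auto

lemma slice_col_length: "slice_col H s xs ys \<Longrightarrow> length xs = slice_bot s \<and> length ys = slice_top s"
proof (induction s arbitrary: xs ys)
  case (Cons k s)
  from Cons.prems have "length (take (brick_bot k) xs) = brick_bot k"
      "length (take (brick_top k) ys) = brick_top k"
    by (auto dest: brick_col_length simp del: length_take)
  moreover have "length (drop (brick_bot k) xs) = slice_bot s"
      "length (drop (brick_top k) ys) = slice_top s"
    using Cons.IH[of "drop (brick_bot k) xs" "drop (brick_top k) ys"] Cons.prems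
    by (auto simp del: length_drop)
  moreover have "length zs = length (take n zs) + length (drop n zs)" for n and zs :: "'a list"
    by simp
  ultimately have "length xs = brick_bot k + slice_bot s" "length ys = brick_top k + slice_top s"
    by metis+
  then show ?case by (simp add: slice_bot_def slice_top_def)
qed (simp add: slice_bot_def slice_top_def)

lemma diagram_col_lengths:
  assumes "diagram_col H D L" "is_diagram m D n" "length (hd L) = m"
  shows "map length L = map slice_bot D @ [n]"
  using assms
proof (induction D arbitrary: L m)
  case (Cons s D)
  then obtain xs L' where L: "L = xs # L'" "slice_col H s xs (hd L')" "diagram_col H D L'"
    by (cases L) auto
  show ?case
    using Cons.IH[OF L(3), of "slice_top s"] slice_col_length[OF L(2)] Cons.prems L(1) by simp
qed auto

section \<open>The determinant in terms of colourings\<close>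

definition colouring_matrix :: "diagram \<Rightarrow> int mat" where
  "colouring_matrix D = (let up = SOME up. orientation D up in
     map_mat (\<lambda>p. poly p (- 1)) (mat_delete (alexander_matrix D up) 0 0))"

lemma link_det_colouring_matrix: "link_det D = \<bar>det (colouring_matrix D)\<bar>"
proof -
  interpret e: comm_ring_hom "\<lambda>p :: int poly. poly p (- 1)" by unfold_locales simp_all
  show ?thesis
    by (simp add: link_det_def alexander_poly_def colouring_matrix_def Let_def e.hom_det)
qed

section \<open>The minor of a diagram that starts with a single cup\<close>

context
  fixes R :: diagram and up :: "nat \<Rightarrow> bool" and N :: nat
  assumes R: "is_diagram 2 R 0"
  defines "up \<equiv> SOME up. orientation ([Cup] # R) up"
    and "N \<equiv> edges R"
begin

lemma edges_pos: "N \<ge> 2"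
  using R by (cases R) (auto simp: N_def edges_def)

definition fox_rows :: "(nat \<Rightarrow> int poly) list" where
  "fox_rows = concat (map (brick_rows up) (place_from 0 R))"

text \<open>A numerator closure starts with a cup, so the deleted row 0 is the condition of this
  cup. The cup has no bottom edges, so the other rows are those of R with its edges numbered from
  0.\<close>

lemma alexander_rows_Cup: "alexander_rows ([Cup] # R) up = eq_row 0 1 # fox_rows"
  by (simp add: alexander_rows_def fox_rows_def slice_bot_def)

lemma edges_Cup: "edges ([Cup] # R) = N"
  by (simp add: edges_def N_def slice_bot_def)

lemma length_rows: "length fox_rows = N - 1"
proof -
  have "link_diagram ([Cup] # R)" using R by (simp add: slice_bot_def slice_top_def)
  from length_alexander_rows[OF this, of up] show ?thesis
    by (simp add: alexander_rows_Cup edges_Cup)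
qed

lemma colouring_matrix_eq:
  "colouring_matrix ([Cup] # R) =
    mat (N - 1) (N - 1) (\<lambda>(i, j). poly ((fox_rows ! i) (Suc j)) (- 1))"
proof -
  have "colouring_matrix ([Cup] # R) =
      map_mat (\<lambda>p. poly p (- 1)) (mat_delete (alexander_matrix ([Cup] # R) up) 0 0)"
    by (simp only: colouring_matrix_def Let_def up_def)
  also have "\<dots> = mat (N - 1) (N - 1) (\<lambda>(i, j). poly ((fox_rows ! i) (Suc j)) (- 1))"
    using length_rows edges_pos
    by (intro eq_matI) (simp_all add: alexander_matrix_def mat_delete_def alexander_rows_Cup edges_Cup)
  finally show ?thesis .
qed

lemma colouring_matrix_carrier: "colouring_matrix ([Cup] # R) \<in> carrier_mat (N - 1) (N - 1)"
  by (simp add: colouring_matrix_eq)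

lemma colouring_matrix_index:
  assumes "i < N - 1" "j < N - 1"
  shows "colouring_matrix ([Cup] # R) $$ (i, j) = poly ((fox_rows ! i) (Suc j)) (- 1)"
  using assms by (simp add: colouring_matrix_eq)

text \<open>Deleting column 0 amounts to giving edge 0 the colour 0; this is the source of the shift
  by \<open>Suc\<close>.\<close>

lemma eval_row_colouring_matrix:
  assumes "i < N - 1" "c 0 = 0"
  shows "eval_row N c (fox_rows ! i) =
    (\<Sum>j<N - 1. of_int (colouring_matrix ([Cup] # R) $$ (i, j)) * c (Suc j))"
proof -
  have "N = Suc (N - 1)" using edges_pos by simp
  then have "eval_row N c (fox_rows ! i) = (\<Sum>j<Suc (N - 1). of_int (poly ((fox_rows ! i) j) (- 1)) * c j)"
    by (simp add: eval_row_def)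
  then show ?thesis
    using assms unfolding sum.lessThan_Suc_shift by (simp add: colouring_matrix_index)
qed

lemma rows_col:
  "(\<forall>i<N - 1. eval_row N c (fox_rows ! i) \<in> H) \<longleftrightarrow>
    diagram_col H R (levels c 0 (map slice_bot R @ [0]))"
proof -
  have "(\<forall>i<N - 1. eval_row N c (fox_rows ! i) \<in> H) \<longleftrightarrow> (\<forall>f\<in>set fox_rows. eval_row N c f \<in> H)"
    by (simp add: all_set_conv_all_nth length_rows)
  also have "\<dots> \<longleftrightarrow> diagram_col H R (levels c 0 (map slice_bot R @ [0]))"
    using diagram_rows_col[OF R, of 0 N up c H] by (simp add: fox_rows_def N_def)
  finally show ?thesis .
qed

lemma det_colouring_matrix_nonzero:
  assumes "\<And>L :: int list list. diagram_col {0} R L \<Longrightarrow> length (hd L) = 2 \<Longrightarrow> hd (hd L) = 0 \<Longrightarrow>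
    set (concat L) \<subseteq> {0}"
  shows "det (colouring_matrix ([Cup] # R)) \<noteq> 0"
proof
  let ?M = "colouring_matrix ([Cup] # R)"
  assume "det ?M = 0"
  then obtain v where v: "v \<in> carrier_vec (N - 1)" "v \<noteq> 0\<^sub>v (N - 1)" "?M *\<^sub>v v = 0\<^sub>v (N - 1)"
    using det_0_iff_vec_prod_zero[OF colouring_matrix_carrier] by auto
  \<comment> \<open>A kernel vector colours the edges from 1 on; colour 0 on edge 0 restores the
    deleted column.\<close>
  define c where "c j = (case j of 0 \<Rightarrow> 0 | Suc j \<Rightarrow> vec_index v j)" for j
  let ?L = "levels c 0 (map slice_bot R @ [0])"
  have "eval_row N c (fox_rows ! i) = 0" if "i < N - 1" for i
  proof -
    have "eval_row N c (fox_rows ! i) = (\<Sum>j<N - 1. ?M $$ (i, j) * vec_index v j)"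
      using eval_row_colouring_matrix[OF that, of c] by (simp add: c_def)
    also have "\<dots> = vec_index (?M *\<^sub>v v) i"
      using that v(1) colouring_matrix_carrier by (auto simp: scalar_prod_def lessThan_atLeast0)
    finally show ?thesis using v(3) that by simp
  qed
  then have "diagram_col {0} R ?L" using rows_col[of c "{0}"] by simp
  moreover have "length (hd ?L) = 2" "hd (hd ?L) = 0"
    using R by (cases R; auto simp: upt_rec c_def)+
  ultimately have "set (concat ?L) \<subseteq> {0}" by (rule assms)
  then have "c j = 0" if "j < N" for j
    using that by (fastforce simp: concat_levels N_def edges_def)
  then have "vec_index v j = 0" if "j < N - 1" for j
    using that by (metis c_def less_diff_conv nat.case(2) Suc_eq_plus1)
  then show False using v(1,2) by (metis eq_vecI carrier_vecD index_zero_vec)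
qed


end

text \<open>For nonempty S this is the additive subgroup generated by S. The single closure rule
  covers sums, differences and integer multiples at once.\<close>

inductive_set int_span :: "'a::comm_ring_1 set \<Rightarrow> 'a set" for S where
  int_span_base: "x \<in> S \<Longrightarrow> x \<in> int_span S"
| int_span_comb: "x \<in> int_span S \<Longrightarrow> y \<in> int_span S \<Longrightarrow> of_int a * x + of_int b * y \<in> int_span S"

lemma int_span_image:
  fixes N :: nat
  assumes "x \<in> int_span (c ` {..<N})"
  shows "\<exists>z. x = (\<Sum>j<N. of_int (z j) * c j)"
  using assms
proof induction
  case (int_span_base x)
  then obtain i where "i < N" "x = c i" by auto
  have "of_int (if j = i then 1 else 0) * c j = (if j = i then c j else 0)" for j by simp
  then have "x = (\<Sum>j<N. of_int (if j = i then 1 else 0) * c j)"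
    using \<open>i < N\<close> \<open>x = c i\<close> by simp
  then show ?case by (rule exI[of _ "\<lambda>j. if j = i then 1 else 0"])
next
  case (int_span_comb x y a b)
  then obtain z z' where "x = (\<Sum>j<N. of_int (z j) * c j)" "y = (\<Sum>j<N. of_int (z' j) * c j)"
    by auto
  then have "of_int a * x + of_int b * y = (\<Sum>j<N. of_int (a * z j + b * z' j) * c j)"
    by (simp add: sum_distrib_left sum.distrib algebra_simps)
  then show ?case by (rule exI[of _ "\<lambda>j. a * z j + b * z' j"])
qed

text \<open>
  A colouring with k integer parameters takes values in the polynomials of degree less than k; the
  conditions it satisfies up to integer combinations of the rows of P present the group with
  relation matrix P as a quotient of the group presented by the colouring matrix.
\<close>

definition row_lattice :: "int mat \<Rightarrow> int poly set" where
  "row_lattice P = {h. \<exists>u. \<forall>l<dim_col P. coeff h l = (\<Sum>i<dim_row P. u i * P $$ (i, l))}"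

lemma det_dvd_det_colouring_matrix:
  assumes R: "is_diagram 2 R 0" and P: "P \<in> carrier_mat k k"
    and L: "diagram_col (row_lattice P) R L" "length (hd L) = 2" "hd (hd L) = 0"
    and span: "\<And>i. i < k \<Longrightarrow> monom 1 i \<in> int_span (set (concat L))"
  shows "det P dvd det (colouring_matrix ([Cup] # R))"
proof -
  let ?M = "colouring_matrix ([Cup] # R)" and ?N = "edges R"
  define c where "c j = concat L ! j" for j
  have len: "map length L = map slice_bot R @ [0]"
    using diagram_col_lengths[OF L(1) R L(2)] .
  have N: "length (concat L) = ?N"
    by (simp add: length_concat len edges_def)
  have "levels c 0 (map slice_bot R @ [0]) = L"
    using levels_nth[of L c 0] len by (simp add: c_def)
  then have "\<forall>i<?N - 1. eval_row ?N c (fox_rows R ! i) \<in> row_lattice P"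
    using rows_col[OF R, of c "row_lattice P"] L(1) by simp
  then have "\<forall>i. \<exists>u. i < ?N - 1 \<longrightarrow>
      (\<forall>l<k. coeff (eval_row ?N c (fox_rows R ! i)) l = (\<Sum>j<k. u j * P $$ (j, l)))"
    using P by (auto simp: row_lattice_def)
  then obtain u where u: "\<And>i l. i < ?N - 1 \<Longrightarrow> l < k \<Longrightarrow>
      coeff (eval_row ?N c (fox_rows R ! i)) l = (\<Sum>j<k. u i j * P $$ (j, l))"
    by metis
  have c0: "c 0 = 0"
  proof (cases L)
    case (Cons xs L')
    then show ?thesis using L(2,3) by (cases xs) (simp_all add: c_def)
  qed (use L(1) in \<open>cases R; simp\<close>)
  have "set (concat L) = c ` {..<?N}"
    by (auto simp: c_def set_conv_nth[of "concat L"] N simp del: set_concat)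
  then have "\<forall>i. \<exists>z. i < k \<longrightarrow> monom 1 i = (\<Sum>j<?N. of_int (z j) * c j)"
    using span int_span_image[of _ c ?N] by auto
  then obtain z where z: "\<And>i. i < k \<Longrightarrow> monom 1 i = (\<Sum>j<?N. of_int (z i j) * c j)"
    by metis
  have N': "?N = Suc (?N - 1)" using edges_pos[OF R] by simp
  have coeff_of_int_mult: "coeff (of_int a * p) l = a * coeff p l" for a l and p :: "int poly"
    by (simp add: of_int_poly)
  \<comment> \<open>The three matrices for \<open>det_dvd_det\<close>: \<open>?X\<close> lists the
    coefficients of the colours, \<open>?Y\<close> the multipliers that express each condition by
    the rows of P, and \<open>?Z\<close> the integers that express the monomials by the colours.
    Edge 0 is left out; its colour is 0, so it adds nothing to the sums.\<close>
  let ?X = "mat (?N - 1) k (\<lambda>(j, l). coeff (c (Suc j)) l)"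
  let ?Y = "mat (?N - 1) k (\<lambda>(i, j). u i j)"
  let ?Z = "mat k (?N - 1) (\<lambda>(i, j). z i (Suc j))"
  note M = colouring_matrix_carrier[OF R]
  show ?thesis
  proof (rule det_dvd_det[OF M _ _ P])
    show "?M * ?X = ?Y * P"
    proof (rule eq_matI)
      fix i l assume "i < dim_row (?Y * P)" "l < dim_col (?Y * P)"
      then have il: "i < ?N - 1" "l < k" using P by auto
      have "(?M * ?X) $$ (i, l) = (\<Sum>j<?N - 1. ?M $$ (i, j) * coeff (c (Suc j)) l)"
        using il M by (auto simp: scalar_prod_def lessThan_atLeast0)
      also have "\<dots> = coeff (eval_row ?N c (fox_rows R ! i)) l"
        using eval_row_colouring_matrix[where c=c, OF R il(1) c0]
        by (simp add: coeff_sum coeff_of_int_mult)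
      also have "\<dots> = (?Y * P) $$ (i, l)"
        using u[OF il] il P by (auto simp: scalar_prod_def lessThan_atLeast0)
      finally show "(?M * ?X) $$ (i, l) = (?Y * P) $$ (i, l)" .
    qed (use M P in auto)
    show "?Z * ?X = 1\<^sub>m k"
    proof (rule eq_matI)
      fix i l assume il: "i < dim_row (1\<^sub>m k :: int mat)" "l < dim_col (1\<^sub>m k :: int mat)"
      then have "(?Z * ?X) $$ (i, l) = (\<Sum>j<?N - 1. z i (Suc j) * coeff (c (Suc j)) l)"
        by (auto simp: scalar_prod_def lessThan_atLeast0)
      also have "\<dots> = (\<Sum>j<Suc (?N - 1). z i j * coeff (c j) l)"
        unfolding sum.lessThan_Suc_shift by (simp add: c0)
      also have "\<dots> = coeff (monom 1 i) l"
        using z[of i] il N' by (simp add: coeff_sum coeff_of_int_mult)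
      finally show "(?Z * ?X) $$ (i, l) = 1\<^sub>m k $$ (i, l)" using il by simp
    qed auto
  qed auto
qed

lemma brick_col_mono: "brick_col H k xs ys \<Longrightarrow> H \<subseteq> H' \<Longrightarrow> brick_col H' k xs ys"
  by (induction H k xs ys rule: brick_col.induct) auto

lemma slice_col_mono: "slice_col H s xs ys \<Longrightarrow> H \<subseteq> H' \<Longrightarrow> slice_col H' s xs ys"
  by (induction s arbitrary: xs ys) (auto intro: brick_col_mono)

lemma diagram_col_mono: "diagram_col H D L \<Longrightarrow> H \<subseteq> H' \<Longrightarrow> diagram_col H' D L"
  by (induction H D L rule: diagram_col.induct) (auto intro: slice_col_mono)

lemma diagram_col_nonempty: "diagram_col H D L \<Longrightarrow> L \<noteq> []"
  by (cases D; cases L) auto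

definition affine_col :: "'a::comm_ring_1 \<Rightarrow> 'a \<Rightarrow> int list list \<Rightarrow> 'a list list" where
  "affine_col x d = map (map (\<lambda>k. x + of_int k * d))"

text \<open>In every condition the coefficients sum to 0, so the base x cancels and d comes out as a
  factor.\<close>

lemma brick_col_affine:
  "brick_col {0} k xs ys \<Longrightarrow>
    brick_col {0} k (map (\<lambda>k. x + of_int k * d) xs) (map (\<lambda>k. x + of_int k * d) ys)"
proof (induction "{0} :: int set" k xs ys rule: brick_col.induct)
  case (4 y y' z z')
  then have eq: "z = 2 * y - y'" "z' = y" by auto
  show ?case unfolding eq by (simp add: algebra_simps)
next
  case (5 y y' z z')
  then have eq: "z' = 2 * y' - y" "z = y'" by auto
  show ?case unfolding eq by (simp add: algebra_simps)
qed auto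

lemma slice_col_affine:
  "slice_col {0} s xs ys \<Longrightarrow>
    slice_col {0} s (map (\<lambda>k. x + of_int k * d) xs) (map (\<lambda>k. x + of_int k * d) ys)"
  by (induction s arbitrary: xs ys) (auto simp: take_map drop_map intro: brick_col_affine)

lemma diagram_col_affine: "diagram_col {0} D K \<Longrightarrow> diagram_col {0} D (affine_col x d K)"
proof (induction D arbitrary: K)
  case (Cons s D)
  then show ?case
    by (cases K) (auto simp: affine_col_def hd_map intro: slice_col_affine)
qed (auto simp: affine_col_def)

section \<open>Gluing colourings side by side and on top of each other\<close>

lemma slice_col_append:
  "slice_col H (s @ t) xs ys \<longleftrightarrow>
    slice_col H s (take (slice_bot s) xs) (take (slice_top s) ys) \<and>
    slice_col H t (drop (slice_bot s) xs) (drop (slice_top s) ys)"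
  by (induction s arbitrary: xs ys)
    (auto simp: slice_bot_def slice_top_def min_def drop_take add.commute)

lemma slice_col_appendI:
  "slice_col H s xs ys \<Longrightarrow> slice_col H t xs' ys' \<Longrightarrow> slice_col H (s @ t) (xs @ xs') (ys @ ys')"
  using slice_col_length[of H s xs ys] by (simp add: slice_col_append)

lemma slice_col_Strands:
  "slice_col {0} (replicate w Strand) xs ys \<longleftrightarrow> xs = ys \<and> length xs = w"
proof (induction w arbitrary: xs ys)
  case (Suc w)
  show ?case by (cases xs; cases ys) (auto simp: Suc)
qed auto

lemma slice_col_Strands_refl:
  "0 \<in> H \<Longrightarrow> length u = w \<Longrightarrow> slice_col H (replicate w Strand) u u"
  using slice_col_mono[of "{0}" "replicate w Strand" u u H] by (simp add: slice_col_Strands)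

lemma diagram_col_pad:
  assumes "diagram_col H D L" "0 \<in> H"
  shows "diagram_col H (map (\<lambda>s. replicate (length u) Strand @ s @ replicate (length v) Strand) D)
    (map (\<lambda>l. u @ l @ v) L)"
  using assms(1)
proof (induction D arbitrary: L)
  case (Cons s D)
  then obtain xs L' where L: "L = xs # L'" "L' \<noteq> []" "slice_col H s xs (hd L')"
    "diagram_col H D L'"
    by (cases L) auto
  then show ?case
    using Cons.IH[OF L(4)] assms(2)
    by (auto simp: hd_map intro!: slice_col_appendI slice_col_Strands_refl)
qed auto

text \<open>For exact colourings the outer strands carry constant colours u and v through all
  slices. Modulo a larger H these colours could drift from level to level.\<close>

lemma diagram_col_pad_elim:
  assumes "diagram_col {0} (map (\<lambda>s. replicate i Strand @ s @ replicate j Strand) D) L"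
    "is_diagram m D n" "length (hd L) = i + m + j"
  obtains K u v where "diagram_col {0} D K" "length (hd K) = m" "length u = i" "length v = j"
    "L = map (\<lambda>l. u @ l @ v) K"
proof -
  have "\<exists>K u v. diagram_col {0} D K \<and> length (hd K) = m \<and> length u = i \<and> length v = j \<and>
    L = map (\<lambda>l. u @ l @ v) K"
    using assms
  proof (induction D arbitrary: L m)
    case Nil
    then obtain xs where "L = [xs]" "length xs = i + m + j" by auto
    moreover have "xs = take i xs @ take m (drop i xs) @ drop m (drop i xs)"
      by (simp only: append_take_drop_id)
    ultimately show ?case
      by (intro exI[of _ "[take m (drop i xs)]"] exI[of _ "take i xs"] exI[of _ "drop m (drop i xs)"])
        auto
  next
    case (Cons s D)
    then obtain xs L' where L: "L = xs # L'" "L' \<noteq> []"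
      "slice_col {0} (replicate i Strand @ s @ replicate j Strand) xs (hd L')"
      "diagram_col {0} (map (\<lambda>s. replicate i Strand @ s @ replicate j Strand) D) L'"
      by (cases L) auto
    have top: "length (hd L') = i + slice_top s + j" and m: "slice_bot s = m"
      using slice_col_length[OF L(3)] Cons.prems
      by (auto simp: slice_top_def sum_list_replicate)
    obtain K u v where K: "diagram_col {0} D K" "length (hd K) = slice_top s" "length u = i"
      "length v = j" "L' = map (\<lambda>l. u @ l @ v) K"
      using Cons.IH[OF L(4) _ top] Cons.prems(2) by auto
    have hd: "hd L' = u @ hd K @ v" using K(5) L(2) by (simp add: hd_map)
    have sl: "slice_bot (replicate i Strand) = i" "slice_top (replicate i Strand) = i" for i
      by (simp_all add: slice_bot_def slice_top_def sum_list_replicate)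
    have eq: "take i xs = u" "slice_col {0} s (take m (drop i xs)) (hd K)" "drop m (drop i xs) = v"
      using L(3) K(2-4) m by (auto simp: slice_col_append sl slice_col_Strands hd)
    have "xs = take i xs @ take m (drop i xs) @ drop m (drop i xs)"
      by (simp only: append_take_drop_id)
    then have "xs = u @ take m (drop i xs) @ v" unfolding eq .
    moreover have "length xs = i + m + j" using Cons.prems(3) L(1) by simp
    ultimately show ?case
      using eq(2) K L(1,2)
      by (intro exI[of _ "take m (drop i xs) # K"] exI[of _ u] exI[of _ v]) auto
  qed
  then show ?thesis using that by blast
qed

text \<open>The level where A and B meet belongs to both lists and is kept once, hence
  \<open>tl\<close>.\<close>

lemma diagram_col_append:
  assumes "diagram_col H A LA" "diagram_col H B LB" "last LA = hd LB"
  shows "diagram_col H (A @ B) (LA @ tl LB)"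
  using assms(1,3)
proof (induction A arbitrary: LA)
  case Nil
  then show ?case using assms(2) diagram_col_nonempty[OF assms(2)] by (cases LB) auto
next
  case (Cons s A)
  then show ?case by (cases LA) auto
qed

lemma diagram_col_append_elim:
  assumes "diagram_col H (A @ B) L"
  obtains LA LB where "diagram_col H A LA" "diagram_col H B LB" "last LA = hd LB"
    "L = LA @ tl LB"
proof -
  have "\<exists>LA LB. diagram_col H A LA \<and> diagram_col H B LB \<and> last LA = hd LB \<and> L = LA @ tl LB"
    using assms
  proof (induction A arbitrary: L)
    case Nil
    then show ?case
      using diagram_col_nonempty[of H B L] by (intro exI[of _ "[hd L]"] exI[of _ L]) auto
  next
    case (Cons s A)
    then obtain xs L' where L: "L = xs # L'" "slice_col H s xs (hd L')" "diagram_col H (A @ B) L'"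
      by (cases L) auto
    from Cons.IH[OF L(3)] obtain LA LB where "diagram_col H A LA" "diagram_col H B LB"
      "last LA = hd LB" "L' = LA @ tl LB" by auto
    then show ?case
      using L diagram_col_nonempty[of H A LA]
      by (intro exI[of _ "xs # LA"] exI[of _ LB]) auto
  qed
  then show ?thesis using that by blast
qed

lemma diagram_col_length_last:
  assumes "diagram_col H D L" "is_diagram m D n" "length (hd L) = m"
  shows "length (last L) = n"
  using arg_cong[OF diagram_col_lengths[OF assms], of last] diagram_col_nonempty[OF assms(1)]
  by (simp add: last_map)

lemma diagram_col_single: "diagram_col H [s] L \<longleftrightarrow> (\<exists>xs ys. L = [xs, ys] \<and> slice_col H s xs ys)"
  by (cases L rule: list.exhaust[case_product list.exhaust[of "tl L"]]) auto

text \<open>Follows the drawing of \<open>hsum\<close>: while A is drawn, the bottom ends of B run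
  beside it unchanged, and while B is drawn, the top ends of A do. The level between the two
  drawings is listed once.\<close>

definition hsum_levels :: "'a list list \<Rightarrow> 'a list list \<Rightarrow> 'a list list" where
  "hsum_levels K L =
    [[hd (hd K), last (hd L)]] @ map (\<lambda>l. l @ hd L) K @ map (\<lambda>l. last K @ l) (tl L) @
    [[hd (last K), last (last L)]]"

lemma hsum_alt:
  "hsum A B = [[Strand, Cup, Strand]] @
     map (\<lambda>s. replicate 0 Strand @ s @ replicate 2 Strand) A @
     map (\<lambda>s. replicate 2 Strand @ s @ replicate 0 Strand) B @ [[Strand, Cap, Strand]]"
  by (simp add: hsum_def numeral_2_eq_2)

text \<open>At the inner cup the colours agree exactly, at the inner cap only modulo H. Base colours
  can always be chosen to match at the bottom, so each horizontal sum leaves a single defect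
  \<open>e - e'\<close>.\<close>

lemma diagram_col_hsum:
  assumes H: "0 \<in> H" and K: "diagram_col H A K" and L: "diagram_col H B L"
    and ends: "hd K = [a, b]" "hd L = [b, d]" "last K = [a', e]" "last L = [e', d']" "e - e' \<in> H"
  shows "diagram_col H (hsum A B) (hsum_levels K L)"
proof -
  have ne: "K \<noteq> []" "L \<noteq> []" using K L diagram_col_nonempty by auto
  have 1: "diagram_col H [[Strand, Cup, Strand]] [[a, d], [a, b, b, d]]"
    using H by (simp add: diagram_col_single)
  have 2: "diagram_col H (map (\<lambda>s. replicate 0 Strand @ s @ replicate 2 Strand) A)
      (map (\<lambda>l. l @ hd L) K)"
    using diagram_col_pad[OF K H, of "[]" "hd L"] ends by (simp add: numeral_2_eq_2)
  have 3: "diagram_col H (map (\<lambda>s. replicate 2 Strand @ s @ replicate 0 Strand) B)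
      (map (\<lambda>l. last K @ l) L)"
    using diagram_col_pad[OF L H, of "last K" "[]"] ends by (simp add: numeral_2_eq_2)
  have 4: "diagram_col H [[Strand, Cap, Strand]] [[a', e, e', d'], [a', d']]"
    using H ends by (simp add: diagram_col_single)
  have "diagram_col H (hsum A B) ([[a, d], [a, b, b, d]] @ tl (map (\<lambda>l. l @ hd L) K @
      tl (map (\<lambda>l. last K @ l) L @ tl [[a', e, e', d'], [a', d']])))"
    unfolding hsum_alt using ne ends
    by (intro diagram_col_append 1 2 3 4) (auto simp: hd_append hd_map last_map)
  also have "[[a, d], [a, b, b, d]] @ tl (map (\<lambda>l. l @ hd L) K @
      tl (map (\<lambda>l. last K @ l) L @ tl [[a', e, e', d'], [a', d']])) = hsum_levels K L"
    using ne ends by (cases K; cases L) (auto simp: hsum_levels_def)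
  finally show ?thesis .
qed

lemma slice_col_Cup_row:
  "slice_col {0} [Strand, Cup, Strand] xs ys \<longleftrightarrow> (\<exists>a b d. xs = [a, d] \<and> ys = [a, b, b, d])"
  using slice_col_length[of "{0}" "[Strand, Cup, Strand]" xs ys]
  by (auto simp: slice_bot_def slice_top_def length_Suc_conv numeral_eq_Suc)

lemma slice_col_Cap_row:
  "slice_col {0} [Strand, Cap, Strand] xs ys \<longleftrightarrow> (\<exists>a b d. xs = [a, b, b, d] \<and> ys = [a, d])"
  using slice_col_length[of "{0}" "[Strand, Cap, Strand]" xs ys]
  by (auto simp: slice_bot_def slice_top_def length_Suc_conv numeral_eq_Suc)

lemma diagram_col_hsum_elim:
  assumes M: "diagram_col {0} (hsum A B) M" and A: "is_diagram 2 A 2" and B: "is_diagram 2 B 2"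
  obtains K L a b d a' e d' where "diagram_col {0} A K" "diagram_col {0} B L"
    "hd K = [a, b]" "hd L = [b, d]" "last K = [a', e]" "last L = [e, d']" "M = hsum_levels K L"
proof -
  obtain M1 M' where 1: "diagram_col {0} [[Strand, Cup, Strand]] M1" "last M1 = hd M'"
      "M = M1 @ tl M'"
      "diagram_col {0} (map (\<lambda>s. replicate 0 Strand @ s @ replicate 2 Strand) A @
        map (\<lambda>s. replicate 2 Strand @ s @ replicate 0 Strand) B @ [[Strand, Cap, Strand]]) M'"
    using M unfolding hsum_alt by (rule diagram_col_append_elim) auto
  obtain M2 M'' where 2: "diagram_col {0} (map (\<lambda>s. replicate 0 Strand @ s @ replicate 2 Strand) A) M2"
      "last M2 = hd M''" "M' = M2 @ tl M''"
      "diagram_col {0} (map (\<lambda>s. replicate 2 Strand @ s @ replicate 0 Strand) B @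
        [[Strand, Cap, Strand]]) M''"
    using 1(4) by (rule diagram_col_append_elim) auto
  obtain M3 M4 where 3: "diagram_col {0} (map (\<lambda>s. replicate 2 Strand @ s @ replicate 0 Strand) B) M3"
      "last M3 = hd M4" "M'' = M3 @ tl M4" "diagram_col {0} [[Strand, Cap, Strand]] M4"
    using 2(4) by (rule diagram_col_append_elim) auto
  have ne: "M2 \<noteq> []" "M3 \<noteq> []" using 2(1) 3(1) diagram_col_nonempty by blast+
  obtain a b d where M1: "M1 = [[a, d], [a, b, b, d]]"
    using 1(1) by (auto simp: diagram_col_single slice_col_Cup_row simp del: slice_col.simps)
  have hd2: "hd M2 = [a, b, b, d]" using 1(2) M1 2(3) ne by simp
  obtain K u v where K: "diagram_col {0} A K" "length (hd K) = 2" "length u = 0" "length v = 2"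
      "M2 = map (\<lambda>l. u @ l @ v) K"
    using diagram_col_pad_elim[OF 2(1) A] hd2 by auto
  have neK: "K \<noteq> []" using K(1) diagram_col_nonempty by blast
  have v: "hd K = [a, b]" "v = [b, d]"
    using hd2 K(2-5) neK by (auto simp: hd_map length_Suc_conv numeral_2_eq_2)
  obtain a' e where lK: "last K = [a', e]"
    using diagram_col_length_last[OF K(1) A K(2)] by (auto simp: length_Suc_conv numeral_2_eq_2)
  have hd3: "hd M3 = [a', e, b, d]"
    using 2(2) 3(3) ne lK K(3,5) v neK by (simp add: last_map)
  obtain L u' v' where L: "diagram_col {0} B L" "length (hd L) = 2" "length u' = 2" "length v' = 0"
      "M3 = map (\<lambda>l. u' @ l @ v') L"
    using diagram_col_pad_elim[OF 3(1) B] hd3 by auto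
  have neL: "L \<noteq> []" using L(1) diagram_col_nonempty by blast
  have u': "hd L = [b, d]" "u' = [a', e]"
    using hd3 L(2-5) neL by (auto simp: hd_map length_Suc_conv numeral_2_eq_2)
  obtain e' d' where lL: "last L = [e', d']"
    using diagram_col_length_last[OF L(1) B L(2)] by (auto simp: length_Suc_conv numeral_2_eq_2)
  have "last M3 = [a', e, e', d']" using L(4,5) neL lL u' by (simp add: last_map)
  then have "e' = e" "M4 = [[a', e, e, d'], [a', d']]"
    using 3(2,4) by (auto simp: diagram_col_single slice_col_Cap_row simp del: slice_col.simps)
  moreover have "M = hsum_levels K L"
    using 1(3) 2(3) 3(3) M1 K(3,5) L(4,5) v u' lK lL calculation(2) neK neL
    by (cases K; cases L) (auto simp: hsum_levels_def)
  ultimately show ?thesis using that K(1) L(1) v(1) u'(1) lK lL by blast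
qed

text \<open>The level \<open>hd L\<close>, which \<open>tl L\<close> omits, still occurs beside
  every level of K.\<close>

lemma set_concat_hsum_levels:
  assumes "K \<noteq> []" "L \<noteq> []"
  shows "set (concat K) \<union> set (concat L) \<subseteq> set (concat (hsum_levels K L))"
  using assms by (cases K; cases L) (auto simp: hsum_levels_def)

section \<open>Colourings of rational tangles\<close>

text \<open>
  Up to a base colour x and a scale d, the tangle of slope p/q has just one colouring; its colours
  grow by p to the right and by - q upwards.
\<close>

definition rational_col :: "diagram \<Rightarrow> int \<Rightarrow> int \<Rightarrow> int list list \<Rightarrow> bool" where
  "rational_col D p q K \<longleftrightarrow>
     diagram_col {0} D K \<and> hd K = [0, p] \<and> last K = [- q, p - q] \<and>
     (\<forall>L :: int list list. diagram_col {0} D L \<longrightarrow> (\<exists>x d. L = affine_col x d K))"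

lemma hd_affine_col: "K \<noteq> [] \<Longrightarrow> hd (affine_col x d K) = map (\<lambda>k. x + of_int k * d) (hd K)"
  by (simp add: affine_col_def hd_map)

lemma last_affine_col: "K \<noteq> [] \<Longrightarrow> last (affine_col x d K) = map (\<lambda>k. x + of_int k * d) (last K)"
  by (simp add: affine_col_def last_map)

lemma affine_col_affine_col:
  fixes x d :: int
  shows "affine_col x d (affine_col y e K) = affine_col (x + y * d) (e * d) K"
  by (simp add: affine_col_def algebra_simps)

lemma rational_col_Over: "rational_col [[Over]] 1 1 [[0, 1], [- 1, 0]]"
proof -
  have "\<exists>x d. L = affine_col x d [[0, 1], [- 1, 0]]" if col: "diagram_col {0} [[Over]] L"
    for L :: "int list list"
  proof -
    obtain xs ys where L: "L = [xs, ys]" "slice_col {0} [Over] xs ys"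
      using col unfolding diagram_col_single by blast
    then obtain x x' where xs: "xs = [x, x']"
      using slice_col_length[OF L(2)] by (auto simp: slice_bot_def length_Suc_conv numeral_2_eq_2)
    obtain y y' where ys: "ys = [y, y']"
      using slice_col_length[OF L(2)] by (auto simp: slice_top_def length_Suc_conv numeral_2_eq_2)
    have "L = affine_col x (x' - x) [[0, 1], [- 1, 0]]"
      using L(2) by (simp add: L(1) xs ys affine_col_def)
    then show ?thesis by blast
  qed
  then show ?thesis by (simp add: rational_col_def)
qed

lemma rational_col_Under: "rational_col [[Under]] (- 1) 1 [[0, - 1], [- 1, - 2]]"
proof -
  have "\<exists>x d. L = affine_col x d [[0, - 1], [- 1, - 2]]" if col: "diagram_col {0} [[Under]] L"
    for L :: "int list list"
  proof -
    obtain xs ys where L: "L = [xs, ys]" "slice_col {0} [Under] xs ys"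
      using col unfolding diagram_col_single by blast
    then obtain x x' where xs: "xs = [x, x']"
      using slice_col_length[OF L(2)] by (auto simp: slice_bot_def length_Suc_conv numeral_2_eq_2)
    obtain y y' where ys: "ys = [y, y']"
      using slice_col_length[OF L(2)] by (auto simp: slice_top_def length_Suc_conv numeral_2_eq_2)
    have "L = affine_col x (x - x') [[0, - 1], [- 1, - 2]]"
      using L(2) by (simp add: L(1) xs ys affine_col_def)
    then show ?thesis by blast
  qed
  then show ?thesis by (simp add: rational_col_def)
qed

text \<open>The top colours - q and p - q of A become the bottom colours of the crossing B. They
  differ by p, and those of B by e times its scale; as e is its own inverse, the scale is e p. Going
  up through B lowers the left colour by this scale.\<close>

lemma rational_col_vertical:
  assumes A: "rational_col A p q K" and B: "rational_col B e 1 K'" and e: "e * e = 1"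
  shows "\<exists>K. rational_col (A @ B) p (q + e * p) K"
proof -
  let ?K = "K @ tl (affine_col (- q) (e * p) K')"
  have ne: "K \<noteq> []" "K' \<noteq> []"
    using A B by (auto simp: rational_col_def dest: diagram_col_nonempty)
  have e': "e * (e * p) = p" using e by (simp flip: mult.assoc)
  have "diagram_col {0} (A @ B) ?K"
    using A B ne e'
    by (intro diagram_col_append diagram_col_affine)
      (auto simp: rational_col_def hd_affine_col algebra_simps)
  moreover have "hd ?K = [0, p]" using A ne by (simp add: rational_col_def)
  moreover have "last ?K = [- (q + e * p), p - (q + e * p)]"
  proof -
    have "last (affine_col (- q) (e * p) K') = [- (q + e * p), p - (q + e * p)]"
      using B ne e' by (simp add: rational_col_def last_affine_col algebra_simps)
    \<comment> \<open>The first level of \<open>K'\<close> starts with 0 and the last one with - 1,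
      so these are different levels and the last one survives \<open>tl\<close>.\<close>
    moreover have "tl K' \<noteq> []"
      using B ne by (cases K') (auto simp: rational_col_def)
    ultimately show ?thesis using ne by (cases K') (auto simp: affine_col_def)
  qed
  moreover have "\<exists>x d. L = affine_col x d ?K" if col: "diagram_col {0} (A @ B) L" for L :: "int list list"
  proof -
    obtain LA LB where L: "diagram_col {0} A LA" "diagram_col {0} B LB" "last LA = hd LB"
      "L = LA @ tl LB"
      using col by (rule diagram_col_append_elim)
    obtain x d where LA: "LA = affine_col x d K" using A L(1) by (auto simp: rational_col_def)
    obtain y d' where LB: "LB = affine_col y d' K'" using B L(2) by (auto simp: rational_col_def)
    have y: "y = x - q * d" "y + e * d' = x + (p - q) * d"
      using L(3) A B ne by (simp_all add: LA LB rational_col_def hd_affine_col last_affine_col)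
    then have "e * d' = p * d" by (simp add: algebra_simps)
    then have "e * (e * d') = e * (p * d)" by simp
    then have "d' = e * p * d" using e by (simp flip: mult.assoc)
    then have "LB = affine_col x d (affine_col (- q) (e * p) K')"
      using y(1) by (simp add: LB affine_col_affine_col)
    then have "L = affine_col x d ?K" by (simp add: L(4) LA affine_col_def map_tl)
    then show ?thesis by blast
  qed
  ultimately show ?thesis unfolding rational_col_def by blast
qed

lemma affine_col_hsum_levels:
  assumes "K \<noteq> []" "L \<noteq> []" "hd K \<noteq> []" "last K \<noteq> []" "hd L \<noteq> []" "last L \<noteq> []"
  shows "affine_col x d (hsum_levels K L) = hsum_levels (affine_col x d K) (affine_col x d L)"
  using assms
  by (simp add: hsum_levels_def affine_col_def hd_map last_map map_tl o_def)

text \<open>The cup gives B the base p, the bottom right colour of A. The cap equates p - q with p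
  minus the scale of B, so this scale is q, and the bottom right colour becomes p + e q.\<close>

lemma rational_col_hsum:
  assumes A: "rational_col A p q K" and B: "rational_col B e 1 K'"
    and dia: "is_diagram 2 A 2" "is_diagram 2 B 2"
  shows "\<exists>K. rational_col (hsum A B) (p + e * q) q K"
proof -
  let ?K' = "affine_col p q K'"
  let ?K = "hsum_levels K ?K'"
  have ne: "K \<noteq> []" "K' \<noteq> []"
    using A B by (auto simp: rational_col_def dest: diagram_col_nonempty)
  have ends: "hd K = [0, p]" "last K = [- q, p - q]" "hd ?K' = [p, p + e * q]"
      "last ?K' = [p - q, p + (e - 1) * q]"
    using A B ne by (auto simp: rational_col_def hd_affine_col last_affine_col)
  have ne': "?K' \<noteq> []" using ne by (simp add: affine_col_def)
  have "diagram_col {0} (hsum A B) ?K"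
    using A B ends
    by (intro diagram_col_hsum[where b=p and e="p - q" and e'="p - q"] diagram_col_affine)
      (auto simp: rational_col_def)
  moreover have "hd ?K = [0, p + e * q]" "last ?K = [- q, p + e * q - q]"
    using ends by (simp_all add: hsum_levels_def algebra_simps)
  moreover have "\<exists>x d. L = affine_col x d ?K" if col: "diagram_col {0} (hsum A B) L" for L :: "int list list"
  proof -
    obtain LA LB a b c a' f c' where L: "diagram_col {0} A LA" "diagram_col {0} B LB"
      "hd LA = [a, b]" "hd LB = [b, c]" "last LA = [a', f]" "last LB = [f, c']"
      "L = hsum_levels LA LB"
      by (rule diagram_col_hsum_elim[OF col dia])
    obtain x d where LA: "LA = affine_col x d K" using A L(1) by (auto simp: rational_col_def)
    obtain y d' where LB: "LB = affine_col y d' K'" using B L(2) by (auto simp: rational_col_def)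
    have "b = x + p * d" "f = x + (p - q) * d" "b = y" "f = y - d'"
      using L(3-6) A B ne by (auto simp: LA LB rational_col_def hd_affine_col last_affine_col)
    then have "y = x + p * d" "d' = q * d" by (simp_all add: algebra_simps)
    then have "LB = affine_col x d ?K'" by (simp add: LB affine_col_affine_col)
    then have "L = affine_col x d ?K"
      using ne ne' ends by (simp add: L(7) LA affine_col_hsum_levels)
    then show ?thesis by blast
  qed
  ultimately show ?thesis unfolding rational_col_def by blast
qed

lemma mirror_append: "mirror (A @ B) = mirror A @ mirror B"
  by (simp add: mirror_def)

lemma mirror_hsum: "mirror (hsum A B) = hsum (mirror A) (mirror B)"
  by (simp add: mirror_def hsum_def o_def)

lemma mirror_Over: "mirror [[Over]] = [[Under]]"
  by (simp add: mirror_def)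

text \<open>\<open>fraction_tangle\<close> runs the subtractive Euclidean algorithm, which for
  coprime p and q ends in a single crossing. The mirror image runs along with the sign e = - 1 and p
  negated.\<close>

lemma rational_col_fraction_tangle:
  assumes "p > 0" "q > 0" "coprime p q"
  shows "(\<exists>K. rational_col (fraction_tangle p q) (int p) (int q) K) \<and>
    (\<exists>K. rational_col (mirror (fraction_tangle p q)) (- int p) (int q) K)"
  using assms
proof (induction p q rule: fraction_tangle.induct)
  case (1 p q)
  have cr: "is_diagram 2 [[Over]] 2" "is_diagram 2 [[Under]] 2"
    by (simp_all add: slice_bot_def slice_top_def)
  consider "p = q" | "p > q" | "p < q" by linarith
  then show ?case
  proof cases
    case 1
    then have "p = 1" "q = 1" using "1.prems" by auto
    then show ?thesis
      using rational_col_Over rational_col_Under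
      by (subst (1 2) fraction_tangle.simps) (auto simp: mirror_Over)
  next
    case 2
    then have ft: "fraction_tangle p q = hsum (fraction_tangle (p - q) q) [[Over]]"
      using "1.prems" by (subst fraction_tangle.simps) auto
    have "coprime (p - q) q" using "1.prems" 2
      by (metis coprime_iff_gcd_eq_1 gcd_diff1_nat less_imp_le)
    then obtain K K' where "rational_col (fraction_tangle (p - q) q) (int (p - q)) (int q) K"
      "rational_col (mirror (fraction_tangle (p - q) q)) (- int (p - q)) (int q) K'"
      using "1.IH"(1) "1.prems" 2 by auto
    from rational_col_hsum[OF this(1) rational_col_Over is_diagram_fraction_tangle cr(1)]
      rational_col_hsum[OF this(2) rational_col_Under
        is_diagram_mirror[THEN iffD2, OF is_diagram_fraction_tangle] cr(2)]
    show ?thesis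
      using 2 by (simp add: ft mirror_hsum mirror_Over of_nat_diff)
  next
    case 3
    then have ft: "fraction_tangle p q = fraction_tangle p (q - p) @ [[Over]]"
      using "1.prems" by (subst fraction_tangle.simps) auto
    have "coprime p (q - p)" using "1.prems" 3
      by (metis coprime_iff_gcd_eq_1 gcd_diff2_nat less_imp_le gcd.commute gcd_diff1_nat)
    then obtain K K' where "rational_col (fraction_tangle p (q - p)) (int p) (int (q - p)) K"
      "rational_col (mirror (fraction_tangle p (q - p))) (- int p) (int (q - p)) K'"
      using "1.IH"(2) "1.prems" 3 by auto
    from rational_col_vertical[OF this(1) rational_col_Over] rational_col_vertical[OF this(2) rational_col_Under]
    show ?thesis
      using 3 by (simp add: ft mirror_append mirror_Over of_nat_diff)
  qed
qed

section \<open>Montesinos links\<close>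

lemma int_span_mono: "x \<in> int_span S \<Longrightarrow> S \<subseteq> T \<Longrightarrow> x \<in> int_span T"
  by (induction rule: int_span.induct) (auto intro: int_span.intros)

text \<open>The corner colours x, x + p d and x - q d have the differences p d and - q d; Bezout
  combines these to d.\<close>

lemma rational_col_span:
  assumes "rational_col D p q K" "coprime p q"
  shows "d \<in> int_span (set (concat (affine_col x d K)))"
proof -
  let ?S = "set (concat (affine_col x d K))"
  obtain u v where uv: "u * p + v * q = 1"
    using assms(2) bezout_int[of p q] by auto
  have ne: "K \<noteq> []" using assms by (auto simp: rational_col_def dest: diagram_col_nonempty)
  have "set (hd K) \<union> set (last K) \<subseteq> set (concat K)" using ne by (auto intro: hd_in_set last_in_set)
  then have "{0, p, - q} \<subseteq> set (concat K)" using assms by (auto simp: rational_col_def)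
  moreover have "?S = (\<lambda>k. x + of_int k * d) ` set (concat K)"
    by (auto simp: affine_col_def)
  ultimately have "x \<in> ?S" "x + of_int p * d \<in> ?S" "x - of_int q * d \<in> ?S"
    by (force simp: image_iff)+
  note this[THEN int_span_base]
  from int_span_comb[OF this(2) this(1), of 1 "- 1"] int_span_comb[OF this(3) this(1), of 1 "- 1"]
  have "of_int p * d \<in> int_span ?S" "- (of_int q * d) \<in> int_span ?S" by simp_all
  from int_span_comb[OF this, of u "- v"] have "of_int (u * p + v * q) * d \<in> int_span ?S"
    by (simp add: algebra_simps)
  then show ?thesis by (simp add: uv)
qed

lemma diagram_col_Cap: "diagram_col H [[Cap]] L \<longleftrightarrow> (\<exists>x y. L = [[x, y], []] \<and> x - y \<in> H)"
proof
  assume "diagram_col H [[Cap]] L"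
  then obtain xs ys where L: "L = [xs, ys]" "slice_col H [Cap] xs ys"
    unfolding diagram_col_single by blast
  then obtain x y where xs: "xs = [x, y]"
    using slice_col_length[OF L(2)] by (auto simp: slice_bot_def length_Suc_conv numeral_2_eq_2)
  moreover have "ys = []"
    using slice_col_length[OF L(2)] by (simp add: slice_top_def)
  ultimately show "\<exists>x y. L = [[x, y], []] \<and> x - y \<in> H" using L by simp
qed (auto simp: diagram_col_single)

text \<open>The two inner caps give q1 d = q2 d' = q3 d'' for the scales of the three tangles, and
  the closing cap then gives p1 d + p2 d' + p3 d'' = 0. Multiplied by q2 q3 this is the nonzero
  integer of \<open>nz\<close> times d, so all scales vanish, and the base colours follow from the
  colour 0 at the bottom left.\<close>

lemma montesinos_colouring_trivial:
  assumes A: "rational_col A p1 q1 KA" and B: "rational_col B p2 q2 KB" and C: "rational_col C p3 q3 KC"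
    and dia: "is_diagram 2 A 2" "is_diagram 2 B 2" "is_diagram 2 C 2"
    and q: "q1 \<noteq> 0" "q2 \<noteq> 0" "q3 \<noteq> 0"
    and nz: "p1 * q2 * q3 + q1 * p2 * q3 + q1 * q2 * p3 \<noteq> 0"
    and col: "diagram_col {0} (hsum (hsum A B) C @ [[Cap]]) (L :: int list list)"
    and hd0: "hd (hd L) = 0"
  shows "set (concat L) \<subseteq> {0}"
proof -
  obtain M E where M: "diagram_col {0} (hsum (hsum A B) C) M" "diagram_col {0} [[Cap]] E"
    "last M = hd E" "L = M @ tl E"
    using col by (rule diagram_col_append_elim)
  obtain LAB LC b s c t e u where 1: "diagram_col {0} (hsum A B) LAB" "diagram_col {0} C LC"
    "hd LAB = [b, s]" "hd LC = [s, c]" "last LAB = [t, e]" "last LC = [e, u]" "M = hsum_levels LAB LC"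
    by (rule diagram_col_hsum_elim[OF M(1) is_diagram_hsum[OF dia(1,2)] dia(3)])
  obtain LA LB a1 a2 a3 a4 a5 a6 where 2: "diagram_col {0} A LA" "diagram_col {0} B LB"
    "hd LA = [a1, a2]" "hd LB = [a2, a3]" "last LA = [a4, a5]" "last LB = [a5, a6]"
    "LAB = hsum_levels LA LB"
    by (rule diagram_col_hsum_elim[OF 1(1) dia(1,2)])
  obtain x d where LA: "LA = affine_col x d KA" using A 2(1) by (auto simp: rational_col_def)
  obtain y d' where LB: "LB = affine_col y d' KB" using B 2(2) by (auto simp: rational_col_def)
  obtain z d'' where LC: "LC = affine_col z d'' KC" using C 1(2) by (auto simp: rational_col_def)
  have ne: "KA \<noteq> []" "KB \<noteq> []" "KC \<noteq> []"
    using A B C by (auto simp: rational_col_def dest: diagram_col_nonempty)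
  have Aends: "a1 = x" "a2 = x + p1 * d" "a4 = x - q1 * d" "a5 = x + (p1 - q1) * d"
    using 2(3,5) A ne by (simp_all add: LA rational_col_def hd_affine_col last_affine_col)
  have Bends: "a2 = y" "a3 = y + p2 * d'" "a5 = y - q2 * d'" "a6 = y + (p2 - q2) * d'"
    using 2(4,6) B ne by (simp_all add: LB rational_col_def hd_affine_col last_affine_col)
  have Cends: "s = z" "c = z + p3 * d''" "e = z - q3 * d''" "u = z + (p3 - q3) * d''"
    using 1(4,6) C ne by (simp_all add: LC rational_col_def hd_affine_col last_affine_col)
  have AB: "b = a1" "s = a3" "t = a4" "e = a6"
    using 1(3,5) 2(3-7) by (simp_all add: hsum_levels_def)
  have "last M = [t, u]" "hd M = [b, c]" using 1 by (simp_all add: hsum_levels_def)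
  then have ends: "t = u" "b = 0" "L = M @ [[]]"
    using M(2-4) hd0 diagram_col_nonempty[OF M(1)] by (auto simp: diagram_col_Cap)
  have x: "x = 0" using ends AB Aends by simp
  have d': "q2 * d' = q1 * d" using Aends Bends by (simp add: algebra_simps)
  have d'': "q3 * d'' = q1 * d" using Bends Cends AB d' by (simp add: algebra_simps)
  have "p1 * d + p2 * d' + p3 * d'' = 0"
    using ends(1) AB Aends Bends Cends d'' by (simp add: algebra_simps)
  then have "0 = q2 * q3 * (p1 * d + p2 * d' + p3 * d'')" by simp
  also have "\<dots> = p1 * q2 * q3 * d + p2 * q3 * (q2 * d') + p3 * q2 * (q3 * d'')"
    by (simp add: algebra_simps)
  also have "\<dots> = (p1 * q2 * q3 + q1 * p2 * q3 + q1 * q2 * p3) * d"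
    unfolding d' d'' by (simp add: algebra_simps)
  finally have "d = 0" using nz by simp
  then have "d' = 0" "d'' = 0" using d' d'' q by auto
  then have zero: "x = 0" "d = 0" "y = 0" "d' = 0" "z = 0" "d'' = 0"
    using \<open>d = 0\<close> x Aends Bends Cends AB by auto
  have "set (concat (affine_col 0 0 K :: int list list)) \<subseteq> {0}" for K
    by (auto simp: affine_col_def)
  then have sets: "set (concat LA) \<subseteq> {0}" "set (concat LB) \<subseteq> {0}" "set (concat LC) \<subseteq> {0}"
    unfolding LA LB LC zero by blast+
  have hsum_zero: "set (concat (hsum_levels K K')) \<subseteq> {0}"
    if "set (concat K) \<subseteq> {0}" "set (concat K') \<subseteq> {0}" "K \<noteq> []" "K' \<noteq> []"
      "hd K \<noteq> []" "last K \<noteq> []" "hd K' \<noteq> []" "last K' \<noteq> []" for K K' :: "int list list"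
  proof -
    have "set (hd K) \<subseteq> {0}" "set (last K) \<subseteq> {0}" "set (hd K') \<subseteq> {0}" "set (last K') \<subseteq> {0}"
      using that(1-4) hd_in_set[of K] last_in_set[of K] hd_in_set[of K'] last_in_set[of K']
      by (simp_all del: hd_in_set last_in_set add: UN_subset_iff)
    moreover have "hd l = 0" "last l = 0" if "set l \<subseteq> {0}" "l \<noteq> []" for l :: "int list"
      using that hd_in_set[of l] last_in_set[of l] by blast+
    then have "hd (hd K) = 0" "last (hd K') = 0" "hd (last K) = 0" "last (last K') = 0"
      using calculation that(5-8) by blast+
    moreover have "set (concat (tl K')) \<subseteq> set (concat K')"
      using that(4) by (cases K') auto
    then have "set (concat (tl K')) \<subseteq> {0}" using that(2) by blast
    ultimately show ?thesis
      using that(1) by (simp add: hsum_levels_def UN_subset_iff)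
  qed
  have neL: "LA \<noteq> []" "LB \<noteq> []" "LC \<noteq> []" "LAB \<noteq> []"
    using 1(1,2) 2(1,2) diagram_col_nonempty by blast+
  have "set (concat LAB) \<subseteq> {0}"
    unfolding 2(7) using 2(3-6) by (intro hsum_zero sets neL) simp_all
  then have "set (concat M) \<subseteq> {0}"
    unfolding 1(7) using 1(3-6) by (intro hsum_zero sets neL) simp_all
  then show ?thesis using ends by simp
qed

text \<open>
  The colours of the three tangles have scales 1, X and X^2; what fails to match at the three caps
  that join the tangles gives the rows of the relation matrix.
\<close>

lemma montesinos_colouring_generic:
  fixes p1 q1 p2 q2 p3 q3 :: int
  assumes A: "rational_col A p1 q1 KA" and B: "rational_col B p2 q2 KB" and C: "rational_col C p3 q3 KC"
    and cop: "coprime p1 q1" "coprime p2 q2" "coprime p3 q3"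
  defines "P \<equiv> mat_of_rows_list 3
    [[- q1, q2, 0], [0, - q2, q3], [- q1 - p1, - p2, q3 - p3]]"
  shows "\<exists>L. diagram_col (row_lattice P) (hsum (hsum A B) C @ [[Cap]]) L \<and>
    length (hd L) = 2 \<and> hd (hd L) = 0 \<and> (\<forall>i<3. monom 1 i \<in> int_span (set (concat L)))"
proof -
  define X :: "nat \<Rightarrow> int poly" where "X = monom 1"
  let ?H = "row_lattice P"
  let ?c = "\<lambda>p i. of_int p * X i"
  define LA where "LA = affine_col 0 (X 0) KA"
  \<comment> \<open>Each base is the bottom right colour of the tangle to its left, so both inner
    cups match exactly.\<close>
  define LB where "LB = affine_col (?c p1 0) (X 1) KB"
  define LC where "LC = affine_col (?c p1 0 + ?c p2 1) (X 2) KC"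
  let ?AB = "hsum_levels LA LB"
  let ?M = "hsum_levels ?AB LC"
  have coeff: "coeff (?c p i) l = (if i = l then p else 0)" for p i l
    by (simp add: of_int_poly X_def)
  have P: "dim_row P = 3" "dim_col P = 3"
    by (simp_all add: P_def mat_of_rows_list_def)
  have row: "h \<in> ?H" if "j < 3" "\<And>l. l < 3 \<Longrightarrow> coeff h l = P $$ (j, l)" for h j
  proof -
    have "(\<Sum>i<3. (if i = j then 1 else 0) * P $$ (i, l)) = P $$ (j, l)" for l
      using that(1) by (simp add: if_distrib[of "\<lambda>z. z * _"] cong: if_cong)
    then show ?thesis
      unfolding row_lattice_def P mem_Collect_eq
      using that by (intro exI[of _ "\<lambda>i. if i = j then 1 else 0"]) auto
  qed
  have "(0 :: int poly) \<in> ?H"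
    unfolding row_lattice_def by (auto intro!: exI[of _ "\<lambda>i. 0"])
  then have sub: "{0} \<subseteq> ?H" and zero: "0 \<in> ?H" by auto
  have ne: "KA \<noteq> []" "KB \<noteq> []" "KC \<noteq> []"
    using A B C by (auto simp: rational_col_def dest: diagram_col_nonempty)
  have col: "diagram_col ?H A LA" "diagram_col ?H B LB" "diagram_col ?H C LC"
    unfolding LA_def LB_def LC_def
    using A B C by (auto simp: rational_col_def intro!: diagram_col_mono[OF diagram_col_affine sub])
  have Aends: "hd LA = [0, ?c p1 0]" "last LA = [- ?c q1 0, ?c (p1 - q1) 0]"
    using A ne by (simp_all add: LA_def rational_col_def hd_affine_col last_affine_col)
  have Bends: "hd LB = [?c p1 0, ?c p1 0 + ?c p2 1]"
      "last LB = [?c p1 0 - ?c q2 1, ?c p1 0 + ?c (p2 - q2) 1]"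
    using B ne by (simp_all add: LB_def rational_col_def hd_affine_col last_affine_col)
  have Cends: "hd LC = [?c p1 0 + ?c p2 1, ?c p1 0 + ?c p2 1 + ?c p3 2]"
      "last LC = [?c p1 0 + ?c p2 1 - ?c q3 2, ?c p1 0 + ?c p2 1 + ?c (p3 - q3) 2]"
    using C ne by (simp_all add: LC_def rational_col_def hd_affine_col last_affine_col)
  have ABends: "hd ?AB = [0, ?c p1 0 + ?c p2 1]" "last ?AB = [- ?c q1 0, ?c p1 0 + ?c (p2 - q2) 1]"
    using Aends Bends by (simp_all add: hsum_levels_def)
  have Mends: "hd ?M = [0, ?c p1 0 + ?c p2 1 + ?c p3 2]"
      "last ?M = [- ?c q1 0, ?c p1 0 + ?c p2 1 + ?c (p3 - q3) 2]"
    using ABends Cends by (simp_all add: hsum_levels_def)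
  note entries = P_def mat_of_rows_list_def coeff numeral_3_eq_3 less_Suc_eq numeral_2_eq_2
    left_diff_distrib
  have "diagram_col ?H (hsum A B) ?AB"
    by (rule diagram_col_hsum[OF zero col(1,2) Aends(1) Bends(1) Aends(2) Bends(2)])
      (rule row[of 0], auto simp: entries)
  then have "diagram_col ?H (hsum (hsum A B) C) ?M"
    by (rule diagram_col_hsum[OF zero _ col(3) ABends(1) Cends(1) ABends(2) Cends(2)])
      (rule row[of 1], auto simp: entries)
  \<comment> \<open>The last row of P is the difference of the two top colours joined by the closing
    cap.\<close>
  moreover have "diagram_col ?H [[Cap]] [last ?M, []]"
    unfolding Mends diagram_col_Cap
    by (intro exI conjI, rule refl) (rule row[of 2], auto simp: entries)
  ultimately have "diagram_col ?H (hsum (hsum A B) C @ [[Cap]]) (?M @ tl [last ?M, []])"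
    by (rule diagram_col_append) simp
  moreover have "length (hd (?M @ tl [last ?M, []])) = 2" "hd (hd (?M @ tl [last ?M, []])) = 0"
    using Mends by (simp_all add: hsum_levels_def)
  moreover have "X i \<in> int_span (set (concat (?M @ tl [last ?M, []])))" if "i < 3" for i
  proof -
    have "LA \<noteq> []" "LB \<noteq> []" "LC \<noteq> []" "?AB \<noteq> []"
      using col diagram_col_nonempty by (blast, blast, blast, simp add: hsum_levels_def)
    then have "set (concat LA) \<union> set (concat LB) \<union> set (concat LC) \<subseteq> set (concat ?M)"
      using set_concat_hsum_levels[of LA LB] set_concat_hsum_levels[of ?AB LC] by blast
    moreover have "X 0 \<in> int_span (set (concat LA))" "X 1 \<in> int_span (set (concat LB))"
      "X 2 \<in> int_span (set (concat LC))"
      unfolding LA_def LB_def LC_def by (rule rational_col_span; fact)+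
    ultimately have "X 0 \<in> int_span (set (concat ?M))" "X 1 \<in> int_span (set (concat ?M))"
      "X 2 \<in> int_span (set (concat ?M))"
      using int_span_mono by blast+
    moreover have "i = 0 \<or> i = 1 \<or> i = 2" using that by linarith
    moreover have "set (concat (?M @ tl [last ?M, []])) = set (concat ?M)" by simp
    ultimately show ?thesis by metis
  qed
  ultimately show ?thesis unfolding X_def by blast
qed

lemma montesinos_det_ge:
  assumes A: "rational_col A p1 q1 KA" and B: "rational_col B p2 q2 KB" and C: "rational_col C p3 q3 KC"
    and cop: "coprime p1 q1" "coprime p2 q2" "coprime p3 q3"
    and dia: "is_diagram 2 A 2" "is_diagram 2 B 2" "is_diagram 2 C 2"
    and q: "q1 \<noteq> 0" "q2 \<noteq> 0" "q3 \<noteq> 0"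
    and nz: "p1 * q2 * q3 + q1 * p2 * q3 + q1 * q2 * p3 \<noteq> 0"
  shows "\<bar>p1 * q2 * q3 + q1 * p2 * q3 + q1 * q2 * p3\<bar> \<le>
    link_det (numerator_closure (hsum (hsum A B) C))"
proof -
  let ?R = "hsum (hsum A B) C @ [[Cap]]"
  define P where "P = mat_of_rows_list 3
    [[- q1, q2, 0], [0, - q2, q3], [- q1 - p1, - p2, q3 - p3]]"
  have Pc: "P \<in> carrier_mat 3 3" by (simp add: P_def mat_of_rows_list_def numeral_3_eq_3)
  have "det P = - (p1 * q2 * q3 + q1 * p2 * q3 + q1 * q2 * p3)"
    unfolding det_dim_3[OF Pc]
    by (simp add: P_def mat_of_rows_list_def numeral_2_eq_2 algebra_simps)
  then have det: "\<bar>det P\<bar> = \<bar>p1 * q2 * q3 + q1 * p2 * q3 + q1 * q2 * p3\<bar>" by simp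
  have R: "is_diagram 2 ?R 0"
    by (rule is_diagram_append[OF is_diagram_hsum[OF is_diagram_hsum[OF dia(1,2)] dia(3)]])
      (simp add: slice_bot_def slice_top_def)
  obtain L where L: "diagram_col (row_lattice P) ?R L" "length (hd L) = 2" "hd (hd L) = 0"
      "\<And>i. i < 3 \<Longrightarrow> monom 1 i \<in> int_span (set (concat L))"
    using montesinos_colouring_generic[OF A B C cop] unfolding P_def by blast
  have "det P dvd det (colouring_matrix ([Cup] # ?R))"
    by (rule det_dvd_det_colouring_matrix[OF R Pc L])
  moreover have "det (colouring_matrix ([Cup] # ?R)) \<noteq> 0"
    by (rule det_colouring_matrix_nonzero[OF R])
      (rule montesinos_colouring_trivial[OF A B C dia q nz])
  ultimately have "\<bar>det P\<bar> \<le> \<bar>det (colouring_matrix ([Cup] # ?R))\<bar>"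
    by (simp add: dvd_imp_le_int)
  then show ?thesis
    by (simp add: det link_det_colouring_matrix numerator_closure_def)
qed

section \<open>Crossings\<close>

lemma crossings_append: "crossings (A @ B) = crossings A + crossings B"
  by (simp add: crossings_def)

lemma crossings_hsum: "crossings (hsum A B) = crossings A + crossings B"
proof -
  have "crossings (map (\<lambda>s. s @ [Strand, Strand]) A) = crossings A"
    "crossings (map ((@) [Strand, Strand]) A) = crossings A" for A
    by (induction A) (simp_all add: crossings_def)
  moreover have "crossings [[Strand, Cup, Strand]] = 0" "crossings [[Strand, Cap, Strand]] = 0"
    by (simp_all add: crossings_def)
  ultimately show ?thesis unfolding hsum_def crossings_append by (simp only: add_0 add_0_right)
qed

lemma crossings_mirror: "crossings (mirror A) = crossings A"
proof -
  have "length (filter (\<lambda>k. k = Over \<or> k = Under)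
      (map (\<lambda>k. if k = Over then Under else if k = Under then Over else k) s)) =
      length (filter (\<lambda>k. k = Over \<or> k = Under) s)" for s
    by (induction s) auto
  then show ?thesis by (induction A) (simp_all add: crossings_def mirror_def)
qed

text \<open>Each recursive step draws one crossing and lowers p + q by at least 1; the final
  crossing has p + q >= 2.\<close>

lemma crossings_fraction_tangle:
  assumes "p > 0" "q > 0"
  shows "crossings (fraction_tangle p q) + 1 \<le> p + q"
  using assms
proof (induction p q rule: fraction_tangle.induct)
  case (1 p q)
  have Over: "crossings [[Over]] = 1" by (simp add: crossings_def)
  consider "p = q" | "p > q" | "p < q" by linarith
  then show ?case
  proof cases
    case 1
    then show ?thesis using "1.prems" by (subst fraction_tangle.simps) (simp add: Over)
  next
    case 2
    then have "fraction_tangle p q = hsum (fraction_tangle (p - q) q) [[Over]]"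
      using "1.prems" by (subst fraction_tangle.simps) auto
    then show ?thesis using "1.IH"(1) "1.prems" 2 by (simp add: crossings_hsum Over)
  next
    case 3
    then have "fraction_tangle p q = fraction_tangle p (q - p) @ [[Over]]"
      using "1.prems" by (subst fraction_tangle.simps) auto
    then show ?thesis using "1.IH"(2) "1.prems" 3 by (simp add: crossings_append Over)
  qed
qed

lemma crossings_numerator_closure: "crossings (numerator_closure A) = crossings A"
  by (simp add: numerator_closure_def crossings_def)

section \<open>Comparing the standard diagram with the determinant\<close>

lemma ambient_isotopic_refl: "ambient_isotopic K K"
  unfolding ambient_isotopic_def
proof (intro exI[of _ "\<lambda>t x. x"] conjI ballI)
  show "continuous_on ({0..1} \<times> UNIV) (\<lambda>(t :: real, x :: point). x)"
    by (simp add: case_prod_beta continuous_on_snd)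
  show "\<exists>G. homeomorphism UNIV UNIV (\<lambda>x :: point. x) G"
    by (rule exI[of _ "\<lambda>x. x"]) (simp add: homeomorphism_def)
qed simp_all

lemma crossing_number_le_crossings:
  "link_diagram D \<Longrightarrow> crossing_number (link_of D) \<le> crossings D"
  unfolding crossing_number_def using ambient_isotopic_refl by (intro Least_le) blast

lemma crossing_number_montesinos_le_det:
  fixes p1 q1 p3 q3 :: nat and r :: rat
  assumes pos: "p1 > 0" "q1 > 0" "p3 > 0" "q3 > 0" "r > 0"
    and cop: "coprime p1 q1" "coprime p3 q3"
    and slopes: "q1 * p3 < p1 * q3" and size: "p1 + q1 + p3 + q3 \<le> q1 * q3 + 2"
  shows "int (crossing_number (link_of
      (montesinos (of_nat p1 / of_nat q1) r (- (of_nat p3 / of_nat q3)))))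
    \<le> link_det (montesinos (of_nat p1 / of_nat q1) r (- (of_nat p3 / of_nat q3)))"
proof -
  obtain p2 q2 :: nat where r: "p2 > 0" "q2 > 0" "coprime p2 q2" "r = of_nat p2 / of_nat q2"
    using pos_rat_cases[OF pos(5)] .
  let ?A = "fraction_tangle p1 q1" and ?B = "fraction_tangle p2 q2"
  let ?C = "mirror (fraction_tangle p3 q3)"
  let ?D = "numerator_closure (hsum (hsum ?A ?B) ?C)"
  have D: "montesinos (of_nat p1 / of_nat q1) r (- (of_nat p3 / of_nat q3)) = ?D"
    using pos cop r by (simp add: montesinos_def rational_tangle_uminus rational_tangle_pos)
  obtain KA KB KC where K: "rational_col ?A (int p1) (int q1) KA"
    "rational_col ?B (int p2) (int q2) KB" "rational_col ?C (- int p3) (int q3) KC"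
    using rational_col_fraction_tangle pos cop r by meson
  let ?\<Delta> = "int p1 * int q2 * int q3 + int q1 * int p2 * int q3 + int q1 * int q2 * (- int p3)"
  have "?\<Delta> = int q2 * int (p1 * q3 - q1 * p3) + int p2 * int (q1 * q3)"
    using slopes by (simp add: of_nat_diff algebra_simps)
  \<comment> \<open>The difference of the outer slopes has a positive integer numerator, hence at
    least 1.\<close>
  moreover have "q2 * 1 \<le> q2 * (p1 * q3 - q1 * p3)"
    using slopes by (intro mult_left_mono) auto
  then have "int q2 \<le> int q2 * int (p1 * q3 - q1 * p3)"
    by (simp only: of_nat_mult[symmetric] of_nat_le_iff mult_1_right)
  moreover have "int (q1 * q3) + int p2 \<le> int p2 * int (q1 * q3) + 1"
  proof -
    \<comment> \<open>For factors x, y >= 1 the product exceeds the sum by at least - 1. This splits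
      the mixed term into a part with p2 and a part with q1 q3.\<close>
    have "0 \<le> (int p2 - 1) * (int (q1 * q3) - 1)"
      using r pos by (intro mult_nonneg_nonneg) (auto simp: Suc_le_eq simp flip: of_nat_mult)
    then show ?thesis by (simp add: algebra_simps)
  qed
  ultimately have \<Delta>: "int q2 + int (q1 * q3) + int p2 - 1 \<le> ?\<Delta>" by linarith
  have "crossings ?D + 3 \<le> (p1 + q1) + (p2 + q2) + (p3 + q3)"
    using crossings_fraction_tangle[OF pos(1,2)] crossings_fraction_tangle[OF r(1,2)]
      crossings_fraction_tangle[OF pos(3,4)]
    by (simp add: crossings_numerator_closure crossings_hsum crossings_mirror)
  then have "int (crossings ?D) \<le> ?\<Delta>" using \<Delta> size by linarith
  moreover have "?\<Delta> \<noteq> 0" using \<Delta> r pos by (simp add: flip: of_nat_mult)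
  then have "\<bar>?\<Delta>\<bar> \<le> link_det ?D"
    using K pos cop r
    by (intro montesinos_det_ge is_diagram_fraction_tangle) (auto simp: is_diagram_mirror is_diagram_fraction_tangle)
  moreover have "crossing_number (link_of ?D) \<le> crossings ?D"
    using crossing_number_le_crossings link_diagram_montesinos D by metis
  ultimately show ?thesis unfolding D by linarith
qed

section \<open>The three families\<close>

theorem theorem2p11:
  fixes a1 a2 a3 c1 c2 n :: nat and r :: rat
  assumes "a1 > 0" "a2 > 0" "a3 > 0" "c1 > 0" "c2 > 0" "n > 0"
    and "r > 0"
  shows
    "(1 + int a1 * (int a2 - int n) < 0 \<longrightarrow>
        (let D = montesinos (conway2 a1 a2) r (- 1 / of_nat n)
         in int (crossing_number (link_of D)) \<le> link_det D)) \<and>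
     (a2 < c2 \<or> (a2 = c2 \<and> a1 > c1) \<longrightarrow>
        (let D = montesinos (conway2 a1 a2) r (- conway2 c1 c2)
         in int (crossing_number (link_of D)) \<le> link_det D)) \<and>
     (a3 < n \<longrightarrow>
        (let D = montesinos (conway3 a1 a2 a3) r (- 1 / of_nat n)
         in int (crossing_number (link_of D)) \<le> link_det D))"
proof -
  have cop: "coprime a (1 + a * b)" for a b :: nat
    by (metis coprime_1_right coprime_iff_gcd_eq_1 gcd_add_mult mult.commute add.commute)
  have n: "- 1 / of_nat n = (- (of_nat 1 / of_nat n) :: rat)" by simp
  have prod: "x + y \<le> x * y + 1" if "x > 0" "y > 0" for x y :: nat
    using that by (cases x; cases y) auto
  have 1: "int (crossing_number (link_of D)) \<le> link_det D"
    if "1 + int a1 * (int a2 - int n) < 0" "D = montesinos (conway2 a1 a2) r (- 1 / of_nat n)" for D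
  proof -
    have less: "1 + a1 * a2 < a1 * n"
    proof -
      have "int (1 + a1 * a2) < int (a1 * n)" using that(1) by (simp add: algebra_simps)
      then show ?thesis by linarith
    qed
    then have "a2 < n" using assms by (metis add_lessD1 mult_less_cancel1 add.commute)
    \<comment> \<open>From n > a2 >= 1 follows n >= 2. The size condition has reduced to a1 + a1 a2
      <= n a1 a2.\<close>
    then have "2 * (a1 * a2) \<le> n * (a1 * a2)" using assms by (intro mult_right_mono) auto
    moreover have "a1 * 1 \<le> a1 * a2" using assms by (intro mult_left_mono) auto
    moreover have "(1 + a1 * a2) * n = n + n * (a1 * a2)" by simp
    ultimately have "a1 + (1 + a1 * a2) + 1 + n \<le> (1 + a1 * a2) * n + 2" by linarith
    then show ?thesis
      unfolding that(2) n conway2_eq[OF assms(1)]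
      using assms less by (intro crossing_number_montesinos_le_det cop) auto
  qed
  have 2: "int (crossing_number (link_of D)) \<le> link_det D"
    if "a2 < c2 \<or> (a2 = c2 \<and> a1 > c1)" "D = montesinos (conway2 a1 a2) r (- conway2 c1 c2)" for D
  proof -
    have "c1 + a1 * a2 * c1 < a1 + a1 * c1 * c2"
      using that(1)
    proof
      assume "a2 < c2"
      \<comment> \<open>The gap of at least 1 between a2 and c2 is worth a1 c1 >= c1; strictness
        comes from the remaining a1.\<close>
      then have "a1 * c1 * (a2 + 1) \<le> a1 * c1 * c2" by (intro mult_left_mono) auto
      moreover have "1 * c1 \<le> a1 * c1" using assms by (intro mult_right_mono) auto
      moreover have "a1 * c1 * (a2 + 1) = a1 * a2 * c1 + a1 * c1" by simp
      ultimately show ?thesis using assms by linarith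
    qed (simp add: algebra_simps)
    then have less: "(1 + a1 * a2) * c1 < a1 * (1 + c1 * c2)"
      by (simp add: algebra_simps)
    have "a1 * 1 \<le> a1 * a2" "c1 * 1 \<le> c1 * c2" using assms by (intro mult_left_mono; simp)+
    \<comment> \<open>The size condition has reduced to a1 + c1 <= (a1 a2) (c1 c2) + 1.\<close>
    moreover have "a1 * a2 + c1 * c2 \<le> (a1 * a2) * (c1 * c2) + 1" using assms by (intro prod) auto
    moreover have "(1 + a1 * a2) * (1 + c1 * c2) = 1 + a1 * a2 + c1 * c2 + (a1 * a2) * (c1 * c2)"
      by simp
    ultimately have "a1 + (1 + a1 * a2) + c1 + (1 + c1 * c2) \<le> (1 + a1 * a2) * (1 + c1 * c2) + 2"
      by linarith
    then show ?thesis
      unfolding that(2) conway2_eq[OF assms(1)] conway2_eq[OF assms(4)]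
      using assms less by (intro crossing_number_montesinos_le_det cop) auto
  qed
  have 3: "int (crossing_number (link_of D)) \<le> link_det D"
    if "a3 < n" "D = montesinos (conway3 a1 a2 a3) r (- 1 / of_nat n)" for D
  proof -
    let ?p = "1 + a1 * a2" and ?q = "a1 + a3 + a1 * a2 * a3"
    have q: "?q = a1 + a3 * ?p" by (simp add: algebra_simps)
    have "gcd ?p ?q = gcd a1 ?p"
      unfolding q by (metis gcd.commute gcd_add_mult add.commute)
    then have cop3: "coprime ?p ?q" using cop[of a1 a2] by (simp add: coprime_iff_gcd_eq_1)
    have "a1 * 1 \<le> a1 * a2" using assms by (intro mult_left_mono) auto
    then have a1: "a1 < ?p" by linarith
    have step: "a + b * c < c * (b + 1)" if "a < c" for a b c :: nat
      using that by simp
    \<comment> \<open>The denominator is a1 + a3 p with a1 < p, so it lies below p (a3 + 1).\<close>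
    have "?q < ?p * (a3 + 1)" unfolding q by (rule step[OF a1])
    also have "\<dots> \<le> ?p * n" using that(1) by (intro mult_left_mono) auto
    finally have less: "?q * 1 < ?p * n" unfolding mult_1_right .
    have "a1 * a2 * 1 \<le> a1 * a2 * a3" using assms by (intro mult_left_mono) auto
    then have pq: "?p + 1 \<le> ?q" using assms by linarith
    have size: "p + q + 1 + n \<le> q * n + 2" if "p + 1 \<le> q" "2 \<le> n" for p q :: nat
    proof -
      \<comment> \<open>Replacing p by its bound q - 1 turns the claim into 2 q + n <= q n + 2,
        which factors in this way.\<close>
      have "0 \<le> (int q - 1) * (int n - 2)" using that by (intro mult_nonneg_nonneg) auto
      then have "int (2 * q + n) \<le> int (q * n + 2)" by (simp add: algebra_simps)
      then show ?thesis using that(1) by linarith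
    qed
    have "2 \<le> n" using that(1) assms by linarith
    with pq have "?p + ?q + 1 + n \<le> ?q * n + 2" by (rule size)
    then show ?thesis
      unfolding that(2) n conway3_eq[OF assms(1)]
      using assms less by (intro crossing_number_montesinos_le_det cop3) auto
  qed
  show ?thesis unfolding Let_def using 1 2 3 by blast
qed

end
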